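(* Let $(A,\mu,1_A,\alpha)$ be a Hom-algebra over a field $k$ and let $\lambda,\nu\in k$. Then the following three linear maps $W,Z,X$ form a Hom-Yang-Baxter system (with $V=V'=A$ and $\alpha_V=\alpha_{V'}=\alpha$): $$W: A\otimes A\to A\otimes A,\qquad a\otimes b\mapsto ab\otimes 1_A+\lambda\, 1_A\otimes ab-\alpha(b)\otimes\alpha(a),$$ $$Z: A\otimes A\to A\otimes A,\qquad a\otimes b\mapsto \nu\, ab\otimes 1_A+1_A\otimes ab-\alpha(b)\otimes\alpha(a),$$ $$X: A\otimes A\to A\otimes A,\qquad a\otimes b\mapsto ab\otimes 1_A+1_A\otimes ab-\alpha(b)\otimes\alpha(a).$$
   Context: Throughout, $k$ is a fixed field; vector spaces, linear maps and tensor products are over $k$, and $\tau$ denotes the flip $x\otimes y\mapsto y\otimes x$. A Hom-algebra is a quadruple $(A,\mu,1_A,\alpha)$ where $A$ is a $k$-linear space, $\mu:A\otimes A\to A$ is a $k$-linear map (written $\mu(a\otimes a')=aa'$), $1_A\in A$, and $\alpha:A\to A$ is a linear endomorphism, such that for all $a,a',a''\in A$: $\alpha(aa')=\alpha(a)\alpha(a')$, $\alpha(1_A)=1_A$, $\alpha(a)(a'a'')=(aa')\alpha(a'')$, and $a1_A=1_Aa=\alpha(a)$. Hom-Yang-Baxter commutator: let $V,V',V''$ be vector spaces with linear endomorphisms $\alpha_V,\alpha_{V'},\alpha_{V''}$, and let $R:V\otimes V'\to V\otimes V'$, $S:V\otimes V''\to V\otimes V''$, $T:V'\otimes V''\to V'\otimes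 V''$ be linear maps. The commutator $[R,S,T]:V\otimes V'\otimes V''\to V\otimes V'\otimes V''$ is $$[R,S,T]=R^{12}\circ S^{13}\circ T^{23}-T^{23}\circ S^{13}\circ R^{12},$$ where $R^{12}=R\otimes\alpha_{V''}$, $S^{13}=(\tau\otimes \mathrm{id})\circ(\alpha_{V'}\otimes S)\circ(\tau\otimes \mathrm{id})$ and $T^{23}=\alpha_V\otimes T$. Hom-Yang-Baxter system: let $V,V'$ be vector spaces with linear endomorphisms $\alpha_V,\alpha_{V'}$. A system of linear maps $W:V\otimes V\to V\otimes V$, $Z:V'\otimes V'\to V'\otimes V'$, $X:V\otimes V'\to V\otimes V'$ is called a Hom-Yang-Baxter system if $$[W,W,W]=0,\quad [Z,Z,Z]=0,\quad [W,X,X]=0,\quad [X,X,Z]=0.$$ *)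

theory Defs
  imports "Jordan_Normal_Form.Missing_VectorSpace" "HOL-Algebra.AbelCoset"
begin

section \<open>Tensor products of vector spaces\<close>

text \<open>
  The free vector space on a set \<open>I\<close>: finitely supported functions \<open>I \<rightarrow> K\<close>, as a subspace
  of the space of all functions.
\<close>

definition free_vs :: "('k, 'm) ring_scheme \<Rightarrow> 'i set \<Rightarrow> ('k, 'i \<Rightarrow> 'k) module" where
  "free_vs K I = (ring.func_space K I)
     \<lparr>carrier := {\<phi> \<in> carrier (ring.func_space K I). finite {i \<in> I. \<phi> i \<noteq> \<zero>\<^bsub>K\<^esub>}}\<rparr>"

definition free_unit :: "('k, 'm) ring_scheme \<Rightarrow> 'i set \<Rightarrow> 'i \<Rightarrow> 'i \<Rightarrow> 'k" where
  "free_unit K I i = (\<lambda>j\<in>I. if j = i then \<one>\<^bsub>K\<^esub> else \<zero>\<^bsub>K\<^esub>)"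

text \<open>
  The quotient space. As in the rest of HOL-Algebra, its elements are the cosets of the subspace.
  The ring multiplication inherited by the record type of modules is irrelevant.
\<close>

definition quotient_vs ::
  "('k, 'b, 'm) module_scheme \<Rightarrow> 'b set \<Rightarrow> ('k, 'b set) module" where
  "quotient_vs M N =
     \<lparr>carrier = A_RCOSETS M N, mult = (\<lambda>X Y. N), one = N, zero = N, add = set_add M,
      smult = (\<lambda>c X. \<Union>x\<in>X. a_r_coset M N (c \<odot>\<^bsub>M\<^esub> x))\<rparr>"

definition tensor_relations ::
  "('k, 'm) ring_scheme \<Rightarrow> ('k, 'a, 'n) module_scheme \<Rightarrow> ('k, 'b, 'p) module_scheme \<Rightarrow>
   ('a \<times> 'b \<Rightarrow> 'k) set" where
  "tensor_relations K V W =
     (let F = free_vs K (carrier V \<times> carrier W);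
          e = (\<lambda>v w. free_unit K (carrier V \<times> carrier W) (v, w))
      in {e (v \<oplus>\<^bsub>V\<^esub> v') w \<ominus>\<^bsub>F\<^esub> (e v w \<oplus>\<^bsub>F\<^esub> e v' w) | v v' w.
            v \<in> carrier V \<and> v' \<in> carrier V \<and> w \<in> carrier W} \<union>
         {e v (w \<oplus>\<^bsub>W\<^esub> w') \<ominus>\<^bsub>F\<^esub> (e v w \<oplus>\<^bsub>F\<^esub> e v w') | v w w'.
            v \<in> carrier V \<and> w \<in> carrier W \<and> w' \<in> carrier W} \<union>
         {e (c \<odot>\<^bsub>V\<^esub> v) w \<ominus>\<^bsub>F\<^esub> c \<odot>\<^bsub>F\<^esub> e v w | c v w.
            c \<in> carrier K \<and> v \<in> carrier V \<and> w \<in> carrier W} \<union>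
         {e v (c \<odot>\<^bsub>W\<^esub> w) \<ominus>\<^bsub>F\<^esub> c \<odot>\<^bsub>F\<^esub> e v w | c v w.
            c \<in> carrier K \<and> v \<in> carrier V \<and> w \<in> carrier W})"

definition tensor_null ::
  "('k, 'm) ring_scheme \<Rightarrow> ('k, 'a, 'n) module_scheme \<Rightarrow> ('k, 'b, 'p) module_scheme \<Rightarrow>
   ('a \<times> 'b \<Rightarrow> 'k) set" where
  "tensor_null K V W =
     module.span K (free_vs K (carrier V \<times> carrier W)) (tensor_relations K V W)"

definition tensor_vs ::
  "('k, 'm) ring_scheme \<Rightarrow> ('k, 'a, 'n) module_scheme \<Rightarrow> ('k, 'b, 'p) module_scheme \<Rightarrow>
   ('k, ('a \<times> 'b \<Rightarrow> 'k) set) module" where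
  "tensor_vs K V W = quotient_vs (free_vs K (carrier V \<times> carrier W)) (tensor_null K V W)"

definition pure_tensor ::
  "('k, 'm) ring_scheme \<Rightarrow> ('k, 'a, 'n) module_scheme \<Rightarrow> ('k, 'b, 'p) module_scheme \<Rightarrow>
   'a \<Rightarrow> 'b \<Rightarrow> ('a \<times> 'b \<Rightarrow> 'k) set" where
  "pure_tensor K V W v w =
     a_r_coset (free_vs K (carrier V \<times> carrier W)) (tensor_null K V W)
       (free_unit K (carrier V \<times> carrier W) (v, w))"

definition bilinear_map ::
  "('k, 'm) ring_scheme \<Rightarrow> ('k, 'a, 'n) module_scheme \<Rightarrow> ('k, 'b, 'p) module_scheme \<Rightarrow>
   ('k, 'c, 'q) module_scheme \<Rightarrow> ('a \<Rightarrow> 'b \<Rightarrow> 'c) \<Rightarrow> bool" where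
  "bilinear_map K V W U f \<longleftrightarrow>
     (\<forall>w\<in>carrier W. linear_map K V U (\<lambda>v. f v w)) \<and> (\<forall>v\<in>carrier V. linear_map K W U (f v))"

text \<open>
  The linear map \<open>V \<otimes> W \<rightarrow> U\<close> induced by a bilinear map \<open>f\<close>, i.e. the linear map with
  \<open>v \<otimes> w \<mapsto> f v w\<close>. It sends the coset of a formal combination \<open>\<Sum> \<phi>(v,w) \<cdot> (v,w)\<close> to
  \<open>\<Sum> \<phi>(v,w) \<cdot> f v w\<close>. The values outside the carrier of \<open>V \<otimes> W\<close> are irrelevant.
\<close>

definition free_lift ::
  "('k, 'm) ring_scheme \<Rightarrow> 'i set \<Rightarrow> ('k, 'c, 'q) module_scheme \<Rightarrow> ('i \<Rightarrow> 'c) \<Rightarrow>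
   ('i \<Rightarrow> 'k) \<Rightarrow> 'c" where
  "free_lift K I U f \<phi> = (\<Oplus>\<^bsub>U\<^esub>i\<in>{i \<in> I. \<phi> i \<noteq> \<zero>\<^bsub>K\<^esub>}. \<phi> i \<odot>\<^bsub>U\<^esub> f i)"

definition tensor_lift ::
  "('k, 'm) ring_scheme \<Rightarrow> ('k, 'a, 'n) module_scheme \<Rightarrow> ('k, 'b, 'p) module_scheme \<Rightarrow>
   ('k, 'c, 'q) module_scheme \<Rightarrow> ('a \<Rightarrow> 'b \<Rightarrow> 'c) \<Rightarrow> ('a \<times> 'b \<Rightarrow> 'k) set \<Rightarrow> 'c" where
  "tensor_lift K V W U f X =
     the_elem (free_lift K (carrier V \<times> carrier W) U (\<lambda>(v, w). f v w) ` X)"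

definition tensor_map ::
  "('k, 'm) ring_scheme \<Rightarrow> ('k, 'a, 'n) module_scheme \<Rightarrow> ('k, 'a', 'n') module_scheme \<Rightarrow>
   ('k, 'b, 'p) module_scheme \<Rightarrow> ('k, 'b', 'p') module_scheme \<Rightarrow>
   ('a \<Rightarrow> 'a') \<Rightarrow> ('b \<Rightarrow> 'b') \<Rightarrow> ('a \<times> 'b \<Rightarrow> 'k) set \<Rightarrow> ('a' \<times> 'b' \<Rightarrow> 'k) set" where
  "tensor_map K V V' W W' f g =
     tensor_lift K V W (tensor_vs K V' W') (\<lambda>v w. pure_tensor K V' W' (f v) (g w))"

definition tensor_flip ::
  "('k, 'm) ring_scheme \<Rightarrow> ('k, 'a, 'n) module_scheme \<Rightarrow> ('k, 'b, 'p) module_scheme \<Rightarrow>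
   ('a \<times> 'b \<Rightarrow> 'k) set \<Rightarrow> ('b \<times> 'a \<Rightarrow> 'k) set" where
  "tensor_flip K V W = tensor_lift K V W (tensor_vs K W V) (\<lambda>v w. pure_tensor K W V w v)"

text \<open>The canonical identifications between \<open>(V \<otimes> W) \<otimes> U\<close> and \<open>V \<otimes> (W \<otimes> U)\<close>.\<close>

definition tensor_assoc ::
  "('k, 'm) ring_scheme \<Rightarrow> ('k, 'a, 'n) module_scheme \<Rightarrow> ('k, 'b, 'p) module_scheme \<Rightarrow>
   ('k, 'c, 'q) module_scheme \<Rightarrow>
   (('a \<times> 'b \<Rightarrow> 'k) set \<times> 'c \<Rightarrow> 'k) set \<Rightarrow> ('a \<times> ('b \<times> 'c \<Rightarrow> 'k) set \<Rightarrow> 'k) set" where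
  "tensor_assoc K V W U =
     (let VWU = tensor_vs K V (tensor_vs K W U)
      in tensor_lift K (tensor_vs K V W) U VWU
           (\<lambda>x u. tensor_lift K V W VWU
              (\<lambda>v w. pure_tensor K V (tensor_vs K W U) v (pure_tensor K W U w u)) x))"

definition tensor_assoc' ::
  "('k, 'm) ring_scheme \<Rightarrow> ('k, 'a, 'n) module_scheme \<Rightarrow> ('k, 'b, 'p) module_scheme \<Rightarrow>
   ('k, 'c, 'q) module_scheme \<Rightarrow>
   ('a \<times> ('b \<times> 'c \<Rightarrow> 'k) set \<Rightarrow> 'k) set \<Rightarrow> (('a \<times> 'b \<Rightarrow> 'k) set \<times> 'c \<Rightarrow> 'k) set" where
  "tensor_assoc' K V W U =
     (let VWU = tensor_vs K (tensor_vs K V W) U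
      in tensor_lift K V (tensor_vs K W U) VWU
           (\<lambda>v. tensor_lift K W U VWU
              (\<lambda>w u. pure_tensor K (tensor_vs K V W) U (pure_tensor K V W v w) u)))"


subsection \<open>The universal property\<close>

text \<open>
  The space \<open>V \<otimes> W\<close> is a vector space, \<open>v \<otimes> w\<close> is bilinear, and \<^const>\<open>tensor_lift\<close> yields
  the unique linear map with the prescribed values on pure tensors: see \<open>bilinear_pure\<close>, \<open>lift\<close>
  and \<open>linear_eqI\<close> below.
\<close>

lemma func_space_simps:
  assumes "cring K"
  shows "carrier (ring.func_space K I) = I \<rightarrow>\<^sub>E carrier K"
    and "\<zero>\<^bsub>ring.func_space K I\<^esub> = (\<lambda>i\<in>I. \<zero>\<^bsub>K\<^esub>)"
    and "\<phi> \<oplus>\<^bsub>ring.func_space K I\<^esub> \<psi> = (\<lambda>i\<in>I. \<phi> i \<oplus>\<^bsub>K\<^esub> \<psi> i)"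
    and "c \<odot>\<^bsub>ring.func_space K I\<^esub> \<phi> = (\<lambda>i\<in>I. c \<otimes>\<^bsub>K\<^esub> \<phi> i)"
  using assms by (simp_all add: ring.func_space_def cring_def)

lemma free_vs_simps:
  assumes "cring K"
  shows "carrier (free_vs K I) = {\<phi> \<in> I \<rightarrow>\<^sub>E carrier K. finite {i \<in> I. \<phi> i \<noteq> \<zero>\<^bsub>K\<^esub>}}"
    and "\<zero>\<^bsub>free_vs K I\<^esub> = (\<lambda>i\<in>I. \<zero>\<^bsub>K\<^esub>)"
    and "\<phi> \<oplus>\<^bsub>free_vs K I\<^esub> \<psi> = (\<lambda>i\<in>I. \<phi> i \<oplus>\<^bsub>K\<^esub> \<psi> i)"
    and "c \<odot>\<^bsub>free_vs K I\<^esub> \<phi> = (\<lambda>i\<in>I. c \<otimes>\<^bsub>K\<^esub> \<phi> i)"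
  by (simp_all add: free_vs_def func_space_simps[OF assms])

lemma free_vs_module:
  assumes "cring K"
  shows "module K (free_vs K I)"
proof -
  interpret K: cring K by fact
  interpret FS: module K "ring.func_space K I" by (rule K.func_space_is_module)
  have "submodule K {\<phi> \<in> carrier (ring.func_space K I). finite {i \<in> I. \<phi> i \<noteq> \<zero>\<^bsub>K\<^esub>}} (ring.func_space K I)"
  proof (rule submodule.intro, goal_cases)
    case 1 show ?case by (rule FS.module_axioms)
  next
    case 2 then show ?case by auto
  next
    case (3 v w)
    then have "{i \<in> I. (v \<oplus>\<^bsub>ring.func_space K I\<^esub> w) i \<noteq> \<zero>\<^bsub>K\<^esub>} \<subseteq> {i \<in> I. v i \<noteq> \<zero>\<^bsub>K\<^esub>} \<union> {i \<in> I. w i \<noteq> \<zero>\<^bsub>K\<^esub>}"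
      by (auto simp: func_space_simps[OF assms])
    with 3 show ?case by (auto intro: finite_subset)
  next
    case 4 then show ?case by (auto simp: func_space_simps[OF assms])
  next
    case (5 c v)
    then have "{i \<in> I. (c \<odot>\<^bsub>ring.func_space K I\<^esub> v) i \<noteq> \<zero>\<^bsub>K\<^esub>} \<subseteq> {i \<in> I. v i \<noteq> \<zero>\<^bsub>K\<^esub>}"
      by (auto simp: func_space_simps[OF assms])
    with 5 show ?case by (auto intro: finite_subset)
  qed
  then show ?thesis unfolding free_vs_def by (rule FS.submodule_is_module)
qed

lemma free_unit_closed:
  assumes "cring K" "i \<in> I"
  shows "free_unit K I i \<in> carrier (free_vs K I)"
proof -
  interpret K: cring K by fact
  have "{j \<in> I. free_unit K I i j \<noteq> \<zero>\<^bsub>K\<^esub>} \<subseteq> {i}" by (auto simp: free_unit_def)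
  then show ?thesis using finite_subset[of _ "{i}"]
    by (auto simp: free_vs_simps[OF assms(1)]) (auto simp: free_unit_def)
qed

locale module_quotient = M?: module R M for R and M (structure) + fixes N
  assumes sub: "submodule R N M"
begin

lemma abelian_subgroup: "abelian_subgroup N M"
proof (rule abelian_subgroupI3)
  have "\<ominus> x \<in> N" if "x \<in> N" for x
  proof -
    have "x \<in> carrier M" using that submodule.subset[OF sub] by auto
    then have "\<ominus> x = (\<ominus>\<^bsub>R\<^esub> \<one>\<^bsub>R\<^esub>) \<odot> x" by (simp add: smult_l_minus)
    then show ?thesis using submodule.smult_closed[OF sub _ that] by simp
  qed
  then show "additive_subgroup N M"
    using sub unfolding submodule_def
    by (intro additive_subgroup.intro M.add.subgroupI) (auto simp: a_inv_def)
qed (rule M.abelian_group_axioms)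

sublocale N: abelian_subgroup N M by (rule abelian_subgroup)

lemma coset_eq_iff:
  assumes "x \<in> carrier M" "y \<in> carrier M"
  shows "N +> x = N +> y \<longleftrightarrow> x \<ominus> y \<in> N"
  using N.a_rcos_module[OF assms(2,1)] N.a_repr_independence'[of x y] N.a_repr_independenceD[OF assms(1), of y] assms
  by (auto simp: a_minus_def)

lemma coset_smult:
  assumes "c \<in> carrier R" "x \<in> carrier M"
  shows "(\<Union>y\<in>N +> x. N +> (c \<odot> y)) = N +> (c \<odot> x)"
proof -
  have "N +> (c \<odot> y) = N +> (c \<odot> x)" if y: "y \<in> N +> x" for y
  proof -
    have yc: "y \<in> carrier M" using N.a_elemrcos_carrier[OF assms(2) y] .
    have "y \<ominus> x \<in> N" using N.a_rcos_module_imp[OF assms(2) y] unfolding a_minus_def .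
    then have "c \<odot> (y \<ominus> x) \<in> N" by (rule submodule.smult_closed[OF sub assms(1)])
    also have "c \<odot> (y \<ominus> x) = c \<odot> y \<ominus> c \<odot> x"
      unfolding a_minus_def using assms yc by (simp only: smult_r_distr smult_r_minus M.a_inv_closed)
    finally show ?thesis by (subst coset_eq_iff) (use assms yc in auto)
  qed
  moreover have "x \<in> N +> x" by (rule N.a_rcos_self[OF assms(2)])
  ultimately show ?thesis by blast
qed

lemma quotient_simps:
  shows "carrier (quotient_vs M N) = (\<lambda>x. N +> x) ` carrier M"
    and "\<zero>\<^bsub>quotient_vs M N\<^esub> = N +> \<zero>"
    and "\<lbrakk>x \<in> carrier M; y \<in> carrier M\<rbrakk> \<Longrightarrow> (N +> x) \<oplus>\<^bsub>quotient_vs M N\<^esub> (N +> y) = N +> (x \<oplus> y)"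
    and "\<lbrakk>c \<in> carrier R; x \<in> carrier M\<rbrakk> \<Longrightarrow> c \<odot>\<^bsub>quotient_vs M N\<^esub> (N +> x) = N +> (c \<odot> x)"
  using sub
  by (auto simp: quotient_vs_def A_RCOSETS_def RCOSETS_def a_r_coset_def[symmetric] N.a_rcos_sum coset_smult
      N.a_rcos_const submodule_def)

lemma quotient_module: "module R (quotient_vs M N)"
proof (rule module_criteria, goal_cases)
  case 1 show ?case by (rule R.cring_axioms)
next
  case 4
  have "(N +> x) \<oplus>\<^bsub>quotient_vs M N\<^esub> (N +> \<ominus> x) = \<zero>\<^bsub>quotient_vs M N\<^esub>" if "x \<in> carrier M" for x
    using that by (simp add: quotient_simps M.r_neg)
  then show ?case by (auto simp: quotient_simps(1))
qed (auto simp: quotient_simps M.a_ac smult_assoc1 smult_l_distr smult_r_distr)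

end

lemma free_vs_finsum:
  assumes "cring K" "finite S" "g \<in> S \<rightarrow> carrier (free_vs K I)"
  shows "finsum (free_vs K I) g S = (\<lambda>i\<in>I. \<Oplus>\<^bsub>K\<^esub>s\<in>S. g s i)"
  using assms(2,3)
proof (induction S)
  case empty
  interpret K: cring K by fact
  interpret F: module K "free_vs K I" by (rule free_vs_module) fact
  show ?case by (simp add: free_vs_simps(2)[OF assms(1)])
next
  case (insert s S)
  interpret K: cring K by fact
  interpret F: module K "free_vs K I" by (rule free_vs_module) fact
  have "g t i \<in> carrier K" if "t \<in> insert s S" "i \<in> I" for t i
    using insert.prems that by (auto simp: free_vs_simps(1)[OF assms(1)] Pi_iff PiE_iff)
  with insert show ?case 
    by (auto simp: free_vs_simps(3)[OF assms(1)] fun_eq_iff Pi_iff F.finsum_insert K.finsum_insert)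
qed

lemma free_vs_expand:
  assumes "cring K" "\<phi> \<in> carrier (free_vs K I)"
  shows "\<phi> = (\<Oplus>\<^bsub>free_vs K I\<^esub>i\<in>{i \<in> I. \<phi> i \<noteq> \<zero>\<^bsub>K\<^esub>}. \<phi> i \<odot>\<^bsub>free_vs K I\<^esub> free_unit K I i)"
proof -
  interpret K: cring K by fact
  interpret F: module K "free_vs K I" by (rule free_vs_module) fact
  let ?S = "{i \<in> I. \<phi> i \<noteq> \<zero>\<^bsub>K\<^esub>}"
  have fin: "finite ?S" and c: "\<And>i. i \<in> I \<Longrightarrow> \<phi> i \<in> carrier K" and e: "\<phi> \<in> extensional I"
    using assms(2) by (auto simp: free_vs_simps(1)[OF assms(1)] PiE_iff)
  have *: "(\<Oplus>\<^bsub>K\<^esub>s\<in>?S. (\<phi> s \<odot>\<^bsub>free_vs K I\<^esub> free_unit K I s) i) = \<phi> i" if i: "i \<in> I" for i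
  proof (cases "i \<in> ?S")
    case True
    have "(\<Oplus>\<^bsub>K\<^esub>s\<in>?S. (\<phi> s \<odot>\<^bsub>free_vs K I\<^esub> free_unit K I s) i) = (\<Oplus>\<^bsub>K\<^esub>s\<in>?S. if i = s then \<phi> s else \<zero>\<^bsub>K\<^esub>)"
      using i c by (intro K.finsum_cong') (auto simp: free_vs_simps(4)[OF assms(1)] free_unit_def)
    also have "\<dots> = \<phi> i" using K.finsum_singleton[OF True fin, of \<phi>] c by auto
    finally show ?thesis .
  next
    case False
    have "(\<Oplus>\<^bsub>K\<^esub>s\<in>?S. (\<phi> s \<odot>\<^bsub>free_vs K I\<^esub> free_unit K I s) i) = (\<Oplus>\<^bsub>K\<^esub>s\<in>?S. \<zero>\<^bsub>K\<^esub>)"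
      using i c False by (intro K.finsum_cong') (auto simp: free_vs_simps(4)[OF assms(1)] free_unit_def)
    with False i show ?thesis by simp
  qed
  have "(\<Oplus>\<^bsub>free_vs K I\<^esub>i\<in>?S. \<phi> i \<odot>\<^bsub>free_vs K I\<^esub> free_unit K I i)
     = (\<lambda>i\<in>I. \<Oplus>\<^bsub>K\<^esub>s\<in>?S. (\<phi> s \<odot>\<^bsub>free_vs K I\<^esub> free_unit K I s) i)"
    using c by (intro free_vs_finsum assms fin) (auto intro!: F.smult_closed free_unit_closed assms)
  also have "\<dots> = \<phi>" using * e by (auto simp: fun_eq_iff extensional_def)
  finally show ?thesis by simp
qed

lemma free_lift_superset:
  assumes "module K U" "\<phi> \<in> carrier (free_vs K I)" "f \<in> I \<rightarrow> carrier U"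
    "finite S" "{i \<in> I. \<phi> i \<noteq> \<zero>\<^bsub>K\<^esub>} \<subseteq> S" "S \<subseteq> I"
  shows "free_lift K I U f \<phi> = (\<Oplus>\<^bsub>U\<^esub>i\<in>S. \<phi> i \<odot>\<^bsub>U\<^esub> f i)"
proof -
  interpret U: module K U by fact
  show ?thesis unfolding free_lift_def
    using assms(2-) U.R.cring_axioms
    by (intro U.add.finprod_mono_neutral_cong_left[folded finsum_def, simplified])
       (auto simp: free_vs_simps Pi_iff PiE_iff subset_iff)
qed

lemma free_lift_hom:
  assumes "module K U" "f \<in> I \<rightarrow> carrier U"
  shows "mod_hom K (free_vs K I) U (free_lift K I U f)"
proof -
  interpret U: module K U by fact
  have cr: "cring K" by (rule U.R.cring_axioms)
  interpret F: module K "free_vs K I" by (rule free_vs_module) fact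
  let ?s = "\<lambda>\<phi>. {i \<in> I. \<phi> i \<noteq> \<zero>\<^bsub>K\<^esub>}"
  have fin: "finite (?s \<phi>)" and c: "\<And>i. i \<in> I \<Longrightarrow> \<phi> i \<in> carrier K" 
    if "\<phi> \<in> carrier (free_vs K I)" for \<phi>
    using that by (auto simp: free_vs_simps(1)[OF cr] PiE_iff)
  show ?thesis
  proof (intro mod_hom.intro mod_hom_axioms.intro, unfold module_hom_def, safe, goal_cases)
    case 1 show ?case by (rule F.module_axioms)
  next
    case 2 show ?case by fact
  next
    case (3 x) then show ?case using assms(2) c unfolding free_lift_def
      by (intro U.finsum_closed) (auto simp: Pi_iff)
  next
    case (4 x y)
    let ?S = "?s x \<union> ?s y"
    have "free_lift K I U f (x \<oplus>\<^bsub>free_vs K I\<^esub> y) = (\<Oplus>\<^bsub>U\<^esub>i\<in>?S. (x \<oplus>\<^bsub>free_vs K I\<^esub> y) i \<odot>\<^bsub>U\<^esub> f i)"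
      using 4 assms fin by (intro free_lift_superset F.a_closed) (auto simp: free_vs_simps(3)[OF cr])
    also have "\<dots> = (\<Oplus>\<^bsub>U\<^esub>i\<in>?S. x i \<odot>\<^bsub>U\<^esub> f i \<oplus>\<^bsub>U\<^esub> y i \<odot>\<^bsub>U\<^esub> f i)"
      using 4 assms(2) c by (intro U.finsum_cong') (auto simp: free_vs_simps(3)[OF cr] U.smult_l_distr Pi_iff)
    also have "\<dots> = (\<Oplus>\<^bsub>U\<^esub>i\<in>?S. x i \<odot>\<^bsub>U\<^esub> f i) \<oplus>\<^bsub>U\<^esub> (\<Oplus>\<^bsub>U\<^esub>i\<in>?S. y i \<odot>\<^bsub>U\<^esub> f i)"
      using 4 assms(2) c by (intro U.finsum_addf) (auto simp: Pi_iff)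
    also have "\<dots> = free_lift K I U f x \<oplus>\<^bsub>U\<^esub> free_lift K I U f y"
      using 4 assms fin by (subst (1 2) free_lift_superset[where S = ?S]) auto
    finally show ?case .
  next
    case (5 r x)
    have "free_lift K I U f (r \<odot>\<^bsub>free_vs K I\<^esub> x) = (\<Oplus>\<^bsub>U\<^esub>i\<in>?s x. (r \<odot>\<^bsub>free_vs K I\<^esub> x) i \<odot>\<^bsub>U\<^esub> f i)"
      using 5 assms fin by (intro free_lift_superset F.smult_closed) (auto simp: free_vs_simps(4)[OF cr])
    also have "\<dots> = (\<Oplus>\<^bsub>U\<^esub>i\<in>?s x. r \<odot>\<^bsub>U\<^esub> (x i \<odot>\<^bsub>U\<^esub> f i))"
      using 5 assms(2) c by (intro U.finsum_cong') (auto simp: free_vs_simps(4)[OF cr] U.smult_assoc1 Pi_iff)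
    also have "\<dots> = r \<odot>\<^bsub>U\<^esub> free_lift K I U f x" unfolding free_lift_def
      using 5 assms(2) c fin by (intro U.finsum_smult_ldistr[symmetric]) (auto simp: Pi_iff)
    finally show ?case .
  qed
qed

lemma free_lift_unit:
  assumes "module K U" "f \<in> I \<rightarrow> carrier U" "i \<in> I"
  shows "free_lift K I U f (free_unit K I i) = f i"
proof -
  interpret U: module K U by fact
  have "free_lift K I U f (free_unit K I i) = (\<Oplus>\<^bsub>U\<^esub>j\<in>{i}. free_unit K I i j \<odot>\<^bsub>U\<^esub> f j)"
    using assms by (intro free_lift_superset free_unit_closed U.R.cring_axioms) (auto simp: free_unit_def split: if_splits)
  also have "\<dots> = f i" using assms by (auto simp: free_unit_def Pi_iff)
  finally show ?thesis .
qed

locale tensor_product =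
  fixes K :: "('k, 'm) ring_scheme"
    and V :: "('k, 'a, 'n) module_scheme"
    and W :: "('k, 'b, 'p) module_scheme"
  assumes vectorspace_V: "vectorspace K V" and vectorspace_W: "vectorspace K W"
begin

lemma module_V: "module K V" and module_W: "module K W" and field_K: "field K" and cring_K: "cring K"
  using vectorspace_V vectorspace_W unfolding vectorspace_def module_def by blast+

interpretation V: module K V by (rule module_V)
interpretation W: module K W by (rule module_W)

abbreviation "I \<equiv> carrier V \<times> carrier W"
abbreviation "F \<equiv> free_vs K I"
abbreviation "N \<equiv> tensor_null K V W"

interpretation F: module K F by (rule free_vs_module) (rule cring_K)

lemma unit_closed: "v \<in> carrier V \<Longrightarrow> w \<in> carrier W \<Longrightarrow> free_unit K I (v, w) \<in> carrier F"
  by (intro free_unit_closed cring_K) auto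

lemma relations_subset: "tensor_relations K V W \<subseteq> carrier F"
  unfolding tensor_relations_def Let_def
  by (safe; intro F.minus_closed F.a_closed F.smult_closed unit_closed V.a_closed W.a_closed
        V.smult_closed W.smult_closed; assumption)

interpretation Q: module_quotient K F N
  unfolding tensor_null_def
  by (intro module_quotient.intro module_quotient_axioms.intro F.module_axioms F.span_is_submodule relations_subset)

lemma vectorspace_T: "vectorspace K (tensor_vs K V W)"
  unfolding tensor_vs_def by (rule vectorspace.intro[OF Q.quotient_module field_K])

lemma module_T: "module K (tensor_vs K V W)"
  using vectorspace_T by (simp add: vectorspace_def)

lemma relation_mem: "x \<in> tensor_relations K V W \<Longrightarrow> x \<in> N"
  using F.in_own_span[OF relations_subset] by (auto simp: tensor_null_def)

lemma pure_closed: "v \<in> carrier V \<Longrightarrow> w \<in> carrier W \<Longrightarrow> pure_tensor K V W v w \<in> carrier (tensor_vs K V W)"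
  by (auto simp: pure_tensor_def tensor_vs_def Q.quotient_simps unit_closed)

lemma pure_add_left:
  assumes "v \<in> carrier V" "v' \<in> carrier V" "w \<in> carrier W"
  shows "pure_tensor K V W (v \<oplus>\<^bsub>V\<^esub> v') w = pure_tensor K V W v w \<oplus>\<^bsub>tensor_vs K V W\<^esub> pure_tensor K V W v' w"
  unfolding pure_tensor_def tensor_vs_def
  by (simp add: Q.coset_eq_iff Q.quotient_simps unit_closed assms)
    (rule relation_mem, unfold tensor_relations_def Let_def, use assms in blast)

lemma pure_add_right:
  assumes "v \<in> carrier V" "w \<in> carrier W" "w' \<in> carrier W"
  shows "pure_tensor K V W v (w \<oplus>\<^bsub>W\<^esub> w') = pure_tensor K V W v w \<oplus>\<^bsub>tensor_vs K V W\<^esub> pure_tensor K V W v w'"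
  unfolding pure_tensor_def tensor_vs_def
  by (simp add: Q.coset_eq_iff Q.quotient_simps unit_closed assms)
    (rule relation_mem, unfold tensor_relations_def Let_def, use assms in blast)

lemma pure_smult_left:
  assumes "c \<in> carrier K" "v \<in> carrier V" "w \<in> carrier W"
  shows "pure_tensor K V W (c \<odot>\<^bsub>V\<^esub> v) w = c \<odot>\<^bsub>tensor_vs K V W\<^esub> pure_tensor K V W v w"
  unfolding pure_tensor_def tensor_vs_def
  by (simp add: Q.coset_eq_iff Q.quotient_simps unit_closed assms)
    (rule relation_mem, unfold tensor_relations_def Let_def, use assms in blast)

lemma pure_smult_right:
  assumes "c \<in> carrier K" "v \<in> carrier V" "w \<in> carrier W"
  shows "pure_tensor K V W v (c \<odot>\<^bsub>W\<^esub> w) = c \<odot>\<^bsub>tensor_vs K V W\<^esub> pure_tensor K V W v w"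
  unfolding pure_tensor_def tensor_vs_def
  by (simp add: Q.coset_eq_iff Q.quotient_simps unit_closed assms)
    (rule relation_mem, unfold tensor_relations_def Let_def, use assms in blast)

lemma bilinear_pure: "bilinear_map K V W (tensor_vs K V W) (pure_tensor K V W)"
  unfolding bilinear_map_def
  by (intro conjI ballI linear_map.intro mod_hom.intro mod_hom_axioms.intro vectorspace_V vectorspace_W
      vectorspace_T module_V module_W module_T)
    (auto simp: module_hom_def pure_closed pure_add_left pure_add_right pure_smult_left pure_smult_right)

lemma linear_eqI:
  assumes "linear_map K (tensor_vs K V W) U f" "linear_map K (tensor_vs K V W) U g"
    and eq: "\<And>v w. v \<in> carrier V \<Longrightarrow> w \<in> carrier W \<Longrightarrow> f (pure_tensor K V W v w) = g (pure_tensor K V W v w)"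
    and x: "x \<in> carrier (tensor_vs K V W)"
  shows "f x = g x"
proof -
  interpret f: linear_map K "tensor_vs K V W" U f by fact
  interpret g: linear_map K "tensor_vs K V W" U g by fact
  let ?q = "\<lambda>\<phi>. a_r_coset F N \<phi>"
  have *: "f (?q (finsum F (\<lambda>i. c i \<odot>\<^bsub>F\<^esub> free_unit K I i) S)) = g (?q (finsum F (\<lambda>i. c i \<odot>\<^bsub>F\<^esub> free_unit K I i) S))"
    if "finite S" "S \<subseteq> I" "c \<in> S \<rightarrow> carrier K" for c S
    using that
  proof (induction S)
    case empty
    have "?q \<zero>\<^bsub>F\<^esub> = \<zero>\<^bsub>tensor_vs K V W\<^esub>" by (simp add: tensor_vs_def Q.quotient_simps)
    then show ?case by (simp add: f.T0_is_0 g.T0_is_0)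
  next
    case (insert s S)
    let ?e = "\<lambda>i. c i \<odot>\<^bsub>F\<^esub> free_unit K I i"
    obtain v w where s: "s = (v, w)" "v \<in> carrier V" "w \<in> carrier W" using insert by auto
    have cl: "?e \<in> insert s S \<rightarrow> carrier F"
      using insert.prems unit_closed by (auto intro!: F.smult_closed)
    have "?q (finsum F ?e (insert s S)) = ?q (c s \<odot>\<^bsub>F\<^esub> free_unit K I s \<oplus>\<^bsub>F\<^esub> finsum F ?e S)"
      using insert cl by (subst F.finsum_insert) auto
    also have "\<dots> = c s \<odot>\<^bsub>tensor_vs K V W\<^esub> pure_tensor K V W v w \<oplus>\<^bsub>tensor_vs K V W\<^esub> ?q (finsum F ?e S)"
      using insert cl s unit_closed by (simp add: tensor_vs_def pure_tensor_def Q.quotient_simps)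
    finally have 1: "?q (finsum F ?e (insert s S)) = \<dots>" .
    have 2: "?q (finsum F ?e S) \<in> carrier (tensor_vs K V W)"
      using cl by (auto simp: tensor_vs_def Q.quotient_simps)
    show ?case unfolding 1 using insert s 2 eq pure_closed by simp
  qed
  obtain \<phi> where phi: "\<phi> \<in> carrier F" "x = ?q \<phi>"
    using x by (auto simp: tensor_vs_def Q.quotient_simps)
  let ?S = "{i \<in> I. \<phi> i \<noteq> \<zero>\<^bsub>K\<^esub>}"
  have "finite ?S" "\<phi> \<in> ?S \<rightarrow> carrier K"
    using phi(1) by (auto simp: free_vs_simps(1)[OF cring_K] PiE_iff)
  from *[OF this(1) _ this(2)] show ?thesis
    using free_vs_expand[OF cring_K phi(1)] phi(2) by auto
qed

lemma lift:
  assumes "vectorspace K U" "bilinear_map K V W U f"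
  shows "linear_map K (tensor_vs K V W) U (tensor_lift K V W U f)"
    and "\<And>v w. v \<in> carrier V \<Longrightarrow> w \<in> carrier W \<Longrightarrow> tensor_lift K V W U f (pure_tensor K V W v w) = f v w"
proof -
  interpret U: module K U using assms(1) by (simp add: vectorspace_def)
  let ?f = "\<lambda>(v, w). f v w"
  let ?L = "free_lift K I U ?f"
  have fl: "linear_map K V U (\<lambda>v. f v w)" if "w \<in> carrier W" for w using assms(2) that by (auto simp: bilinear_map_def)
  have fr: "linear_map K W U (\<lambda>w. f v w)" if "v \<in> carrier V" for v using assms(2) that by (auto simp: bilinear_map_def)
  have fc: "?f \<in> I \<rightarrow> carrier U"
    using fl by (fastforce simp: linear_map_def mod_hom_def mod_hom_axioms_def module_hom_def)
  have add1: "f (v \<oplus>\<^bsub>V\<^esub> v') w = f v w \<oplus>\<^bsub>U\<^esub> f v' w" if "v \<in> carrier V" "v' \<in> carrier V" "w \<in> carrier W" for v v' w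
    using fl[OF that(3)] that by (auto simp: linear_map_def mod_hom_def mod_hom_axioms_def module_hom_def)
  have sm1: "f (c \<odot>\<^bsub>V\<^esub> v) w = c \<odot>\<^bsub>U\<^esub> f v w" if "v \<in> carrier V" "c \<in> carrier K" "w \<in> carrier W" for v c w
    using fl[OF that(3)] that by (auto simp: linear_map_def mod_hom_def mod_hom_axioms_def module_hom_def)
  have add2: "f v (w \<oplus>\<^bsub>W\<^esub> w') = f v w \<oplus>\<^bsub>U\<^esub> f v w'" if "v \<in> carrier V" "w \<in> carrier W" "w' \<in> carrier W" for v w w'
    using fr[OF that(1)] that by (auto simp: linear_map_def mod_hom_def mod_hom_axioms_def module_hom_def)
  have sm2: "f v (c \<odot>\<^bsub>W\<^esub> w) = c \<odot>\<^bsub>U\<^esub> f v w" if "v \<in> carrier V" "c \<in> carrier K" "w \<in> carrier W" for v c w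
    using fr[OF that(1)] that by (auto simp: linear_map_def mod_hom_def mod_hom_axioms_def module_hom_def)
  have fcl: "f v w \<in> carrier U" if "v \<in> carrier V" "w \<in> carrier W" for v w
    using funcset_mem[OF fc, of "(v, w)"] that by simp
  interpret L: mod_hom K F U ?L by (rule free_lift_hom[OF U.module_axioms fc])
  have Lu: "?L (free_unit K I (v, w)) = f v w" if "v \<in> carrier V" "w \<in> carrier W" for v w
    using free_lift_unit[OF U.module_axioms fc, of "(v, w)"] that by simp
  have [simp]: "a \<ominus>\<^bsub>U\<^esub> a = \<zero>\<^bsub>U\<^esub>" if "a \<in> carrier U" for a 
    using that by (simp add: a_minus_def U.M.r_neg)
  have "N \<subseteq> L.ker" unfolding tensor_null_def
  proof (rule F.span_is_subset)
    show "submodule K L.ker F" by (rule L.ker_is_submodule)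
    show "tensor_relations K V W \<subseteq> L.ker"
    proof
      fix x assume x: "x \<in> tensor_relations K V W"
      then have "?L x = \<zero>\<^bsub>U\<^esub>"
        unfolding tensor_relations_def Let_def
      proof (elim UnE CollectE exE conjE, goal_cases)
        case (1 v v' w)
        then show ?case by (simp add: L.f_minus L.f_add unit_closed Lu add1 fcl)
      next
        case (2 v w w')
        then show ?case by (simp add: L.f_minus L.f_add unit_closed Lu add2 fcl)
      next
        case (3 c v w)
        then show ?case by (simp add: L.f_minus L.f_smult unit_closed Lu sm1 fcl)
      next
        case (4 c v w)
        then show ?case by (simp add: L.f_minus L.f_smult unit_closed Lu sm2 fcl)
      qed
      with x show "x \<in> L.ker" unfolding L.ker_def using relations_subset by blast
    qed
  qed
  then have ker: "?L x = \<zero>\<^bsub>U\<^esub>" if "x \<in> N" for x using that unfolding L.ker_def by blast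
  have val: "tensor_lift K V W U f (a_r_coset F N \<phi>) = ?L \<phi>" if phi: "\<phi> \<in> carrier F" for \<phi>
  proof -
    have "?L y = ?L \<phi>" if y: "y \<in> a_r_coset F N \<phi>" for y
    proof -
      obtain n where n: "n \<in> N" "y = n \<oplus>\<^bsub>F\<^esub> \<phi>" using y unfolding a_r_coset_def' by blast
      then have "n \<in> carrier F" using submodule.subset[OF Q.sub] by blast
      then have "?L y = ?L n \<oplus>\<^bsub>U\<^esub> ?L \<phi>" unfolding n(2) using phi by (rule L.f_add)
      then show ?thesis unfolding ker[OF n(1)] using U.l_zero[OF L.f_im[OF phi]] by (rule trans)
    qed
    moreover have "\<phi> \<in> a_r_coset F N \<phi>" by (rule Q.N.a_rcos_self[OF phi])
    ultimately have "?L ` a_r_coset F N \<phi> = {?L \<phi>}" by blast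
    then show ?thesis unfolding tensor_lift_def by (simp only: the_elem_eq)
  qed
  have "tensor_lift K V W U f \<in> module_hom K (quotient_vs F N) U"
    unfolding module_hom_def
  proof (safe, goal_cases)
    case (1 x)
    then show ?case by (auto simp: Q.quotient_simps(1) val intro: L.f_im)
  next
    case (2 x y)
    then obtain \<phi> \<psi> where "x = a_r_coset F N \<phi>" "y = a_r_coset F N \<psi>" "\<phi> \<in> carrier F" "\<psi> \<in> carrier F"
      by (auto simp: Q.quotient_simps(1))
    then show ?case by (simp add: Q.quotient_simps val L.f_add)
  next
    case (3 c x)
    then obtain \<phi> where "x = a_r_coset F N \<phi>" "\<phi> \<in> carrier F"
      by (auto simp: Q.quotient_simps(1))
    with 3 show ?case by (simp add: Q.quotient_simps val L.f_smult)
  qed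
  then show "linear_map K (tensor_vs K V W) U (tensor_lift K V W U f)"
    unfolding tensor_vs_def[symmetric]
    by (intro linear_map.intro mod_hom.intro mod_hom_axioms.intro vectorspace_T module_T assms(1) U.module_axioms)
  fix v w assume "v \<in> carrier V" "w \<in> carrier W"
  then show "tensor_lift K V W U f (pure_tensor K V W v w) = f v w"
    by (simp add: pure_tensor_def val unit_closed Lu)
qed

end


section \<open>Hom-Yang-Baxter systems\<close>

text \<open>
  The threefold tensor product \<open>V \<otimes> V' \<otimes> V''\<close> is taken to be \<open>(V \<otimes> V') \<otimes> V''\<close>; the
  rebracketing that is implicit in the usual notation is made explicit.
\<close>

abbreviation tensor3_vs ::
  "('k, 'm) ring_scheme \<Rightarrow> ('k, 'a, 'n) module_scheme \<Rightarrow> ('k, 'b, 'p) module_scheme \<Rightarrow>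
   ('k, 'c, 'q) module_scheme \<Rightarrow> ('k, (('a \<times> 'b \<Rightarrow> 'k) set \<times> 'c \<Rightarrow> 'k) set) module" where
  "tensor3_vs K V V' V'' \<equiv> tensor_vs K (tensor_vs K V V') V''"

definition leg12 where
  "leg12 K V V' V'' \<alpha>'' R =
     tensor_map K (tensor_vs K V V') (tensor_vs K V V') V'' V'' R \<alpha>''"

definition leg23 where
  "leg23 K V V' V'' \<alpha> T =
     tensor_assoc' K V V' V'' \<circ>
     tensor_map K V V (tensor_vs K V' V'') (tensor_vs K V' V'') \<alpha> T \<circ>
     tensor_assoc K V V' V''"

text \<open>\<open>(\<tau> \<otimes> id) \<circ> (\<alpha>' \<otimes> S) \<circ> (\<tau> \<otimes> id)\<close>, the middle factor acting on \<open>V' \<otimes> V \<otimes> V''\<close>.\<close>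

definition leg13 where
  "leg13 K V V' V'' \<alpha>' S =
     tensor_map K (tensor_vs K V' V) (tensor_vs K V V') V'' V'' (tensor_flip K V' V) id \<circ>
     leg23 K V' V V'' \<alpha>' S \<circ>
     tensor_map K (tensor_vs K V V') (tensor_vs K V' V) V'' V'' (tensor_flip K V V') id"

definition hom_yb_commutator ::
  "('k, 'm) ring_scheme \<Rightarrow>
   ('k, 'a, 'n) module_scheme \<Rightarrow> ('a \<Rightarrow> 'a) \<Rightarrow>
   ('k, 'b, 'p) module_scheme \<Rightarrow> ('b \<Rightarrow> 'b) \<Rightarrow>
   ('k, 'c, 'q) module_scheme \<Rightarrow> ('c \<Rightarrow> 'c) \<Rightarrow>
   (('a \<times> 'b \<Rightarrow> 'k) set \<Rightarrow> ('a \<times> 'b \<Rightarrow> 'k) set) \<Rightarrow>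
   (('a \<times> 'c \<Rightarrow> 'k) set \<Rightarrow> ('a \<times> 'c \<Rightarrow> 'k) set) \<Rightarrow>
   (('b \<times> 'c \<Rightarrow> 'k) set \<Rightarrow> ('b \<times> 'c \<Rightarrow> 'k) set) \<Rightarrow>
   (('a \<times> 'b \<Rightarrow> 'k) set \<times> 'c \<Rightarrow> 'k) set \<Rightarrow> (('a \<times> 'b \<Rightarrow> 'k) set \<times> 'c \<Rightarrow> 'k) set" where
  "hom_yb_commutator K V \<alpha> V' \<alpha>' V'' \<alpha>'' R S T =
     (let R12 = leg12 K V V' V'' \<alpha>'' R;
          S13 = leg13 K V V' V'' \<alpha>' S;
          T23 = leg23 K V V' V'' \<alpha> T
      in (\<lambda>x. (R12 \<circ> S13 \<circ> T23) x \<ominus>\<^bsub>tensor3_vs K V V' V''\<^esub> (T23 \<circ> S13 \<circ> R12) x))"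

locale hom_yb_system =
  fixes K :: "('k, 'm) ring_scheme"
    and V :: "('k, 'a, 'n) module_scheme" and \<alpha> :: "'a \<Rightarrow> 'a"
    and V' :: "('k, 'b, 'p) module_scheme" and \<alpha>' :: "'b \<Rightarrow> 'b"
    and W :: "('a \<times> 'a \<Rightarrow> 'k) set \<Rightarrow> ('a \<times> 'a \<Rightarrow> 'k) set"
    and Z :: "('b \<times> 'b \<Rightarrow> 'k) set \<Rightarrow> ('b \<times> 'b \<Rightarrow> 'k) set"
    and X :: "('a \<times> 'b \<Rightarrow> 'k) set \<Rightarrow> ('a \<times> 'b \<Rightarrow> 'k) set"
  assumes linear_\<alpha>: "linear_map K V V \<alpha>"
    and linear_\<alpha>': "linear_map K V' V' \<alpha>'"
    and linear_W: "linear_map K (tensor_vs K V V) (tensor_vs K V V) W"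
    and linear_Z: "linear_map K (tensor_vs K V' V') (tensor_vs K V' V') Z"
    and linear_X: "linear_map K (tensor_vs K V V') (tensor_vs K V V') X"
    and WWW: "\<And>x. x \<in> carrier (tensor3_vs K V V V) \<Longrightarrow>
      hom_yb_commutator K V \<alpha> V \<alpha> V \<alpha> W W W x = \<zero>\<^bsub>tensor3_vs K V V V\<^esub>"
    and ZZZ: "\<And>x. x \<in> carrier (tensor3_vs K V' V' V') \<Longrightarrow>
      hom_yb_commutator K V' \<alpha>' V' \<alpha>' V' \<alpha>' Z Z Z x = \<zero>\<^bsub>tensor3_vs K V' V' V'\<^esub>"
    and WXX: "\<And>x. x \<in> carrier (tensor3_vs K V V V') \<Longrightarrow>
      hom_yb_commutator K V \<alpha> V \<alpha> V' \<alpha>' W X X x = \<zero>\<^bsub>tensor3_vs K V V V'\<^esub>"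
    and XXZ: "\<And>x. x \<in> carrier (tensor3_vs K V V' V') \<Longrightarrow>
      hom_yb_commutator K V \<alpha> V' \<alpha>' V' \<alpha>' X X Z x = \<zero>\<^bsub>tensor3_vs K V V' V'\<^esub>"


section \<open>Hom-algebras\<close>

abbreviation tensor_mult ::
  "('k, 'm) ring_scheme \<Rightarrow> ('k, 'a, 'n) module_scheme \<Rightarrow> (('a \<times> 'a \<Rightarrow> 'k) set \<Rightarrow> 'a) \<Rightarrow>
   'a \<Rightarrow> 'a \<Rightarrow> 'a" where
  "tensor_mult K A \<mu> a b \<equiv> \<mu> (pure_tensor K A A a b)"

locale hom_algebra =
  fixes K :: "('k, 'm) ring_scheme"
    and A :: "('k, 'a, 'n) module_scheme"
    and \<mu> :: "('a \<times> 'a \<Rightarrow> 'k) set \<Rightarrow> 'a"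
    and u :: 'a
    and \<alpha> :: "'a \<Rightarrow> 'a"
  assumes vectorspace: "vectorspace K A"
    and linear_\<mu>: "linear_map K (tensor_vs K A A) A \<mu>"
    and unit_closed: "u \<in> carrier A"
    and linear_\<alpha>: "linear_map K A A \<alpha>"
    and \<alpha>_mult: "\<lbrakk>a \<in> carrier A; b \<in> carrier A\<rbrakk> \<Longrightarrow>
      \<alpha> (tensor_mult K A \<mu> a b) = tensor_mult K A \<mu> (\<alpha> a) (\<alpha> b)"
    and \<alpha>_unit: "\<alpha> u = u"
    and hom_assoc: "\<lbrakk>a \<in> carrier A; b \<in> carrier A; c \<in> carrier A\<rbrakk> \<Longrightarrow>
      tensor_mult K A \<mu> (\<alpha> a) (tensor_mult K A \<mu> b c) =
      tensor_mult K A \<mu> (tensor_mult K A \<mu> a b) (\<alpha> c)"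
    and unit_right: "a \<in> carrier A \<Longrightarrow> tensor_mult K A \<mu> a u = \<alpha> a"
    and unit_left: "a \<in> carrier A \<Longrightarrow> tensor_mult K A \<mu> u a = \<alpha> a"

end

theory Submission
  imports Defs
begin

text \<open>
  Let \<open>R\<close> be the operator \<open>a \<otimes> b \<mapsto> r ab \<otimes> 1 + s 1 \<otimes> ab - \<alpha>(b) \<otimes> \<alpha>(a)\<close> with coefficients
  \<open>(r, s)\<close>; then \<open>W\<close>, \<open>Z\<close> and \<open>X\<close> are the operators with coefficients \<open>(1, \<lambda>)\<close>, \<open>(\<nu>, 1)\<close> and
  \<open>(1, 1)\<close>. The four commutators of a Hom-Yang-Baxter system are therefore instances of
  one commutator \<open>[R, S, T]\<close>, for operators with coefficients \<open>(r, s)\<close>, \<open>(p, q)\<close>, \<open>(x, y)\<close>.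

  By linearity it suffices to evaluate \<open>[R, S, T]\<close> on \<open>a \<otimes> b \<otimes> c\<close>. Each of the two composites is
  then a sum of \<open>27\<close> pure tensors, and the Hom-algebra axioms reduce these to ten: the product of all
  three letters in one of three places (it does not depend on the bracketing, by
  Hom-associativity), \<open>bc\<close> and \<open>a\<close> in three arrangements, \<open>c\<close> and \<open>ab\<close> in three arrangements,
  and the reversed tensor \<open>c \<otimes> b \<otimes> a\<close>; empty places contain the unit, and the factors carry
  suitable powers of \<open>\<alpha>\<close>. The evaluation is \<open>leg12_pure\<close>, \<open>leg13_pure\<close> and \<open>leg23_pure\<close>.

  Comparing the coefficients of the ten tensors (\<open>yb_left_eq_right\<close>) shows that the commutator vanishes
  as soon as
  \<open>x(q-1)(r-1) = (r-p)(y-1)\<close>,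
  \<open>(q-1)(sx-1) = (s-1)(y-1)\<close>,
  \<open>(p-1)(sx-1) = (r-1)(x-1)\<close> and
  \<open>s(p-1)(y-1) = (r-1)(y-q)\<close>.
  For \<open>[W, W, W]\<close>, \<open>[Z, Z, Z]\<close>, \<open>[W, X, X]\<close> and \<open>[X, X, Z]\<close> these hold at sight.

  The remaining work is to make linear extension precise for tensor products built as
  quotients: the canonical maps between tensor products are linear and have the expected values
  on pure tensors.
\<close>

section \<open>Linear and bilinear maps\<close>

lemma linear_mapI:
  assumes "vectorspace K V" "vectorspace K W"
    and "\<And>x. x \<in> carrier V \<Longrightarrow> f x \<in> carrier W"
    and "\<And>x y. x \<in> carrier V \<Longrightarrow> y \<in> carrier V \<Longrightarrow> f (x \<oplus>\<^bsub>V\<^esub> y) = f x \<oplus>\<^bsub>W\<^esub> f y"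
    and "\<And>c x. c \<in> carrier K \<Longrightarrow> x \<in> carrier V \<Longrightarrow> f (c \<odot>\<^bsub>V\<^esub> x) = c \<odot>\<^bsub>W\<^esub> f x"
  shows "linear_map K V W f"
  using assms
  by (auto intro!: linear_map.intro mod_hom.intro mod_hom_axioms.intro simp: module_hom_def vectorspace_def)

lemma linear_mapD:
  assumes "linear_map K V W f"
  shows "vectorspace K V" "vectorspace K W" "mod_hom K V W f"
    and "\<And>x. x \<in> carrier V \<Longrightarrow> f x \<in> carrier W"
    and "\<And>x y. x \<in> carrier V \<Longrightarrow> y \<in> carrier V \<Longrightarrow> f (x \<oplus>\<^bsub>V\<^esub> y) = f x \<oplus>\<^bsub>W\<^esub> f y"
    and "\<And>c x. c \<in> carrier K \<Longrightarrow> x \<in> carrier V \<Longrightarrow> f (c \<odot>\<^bsub>V\<^esub> x) = c \<odot>\<^bsub>W\<^esub> f x"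
  using assms
  by (auto simp: linear_map_def mod_hom_def mod_hom_axioms_def module_hom_def)

lemma linear_map_comp:
  assumes "linear_map K V W f" "linear_map K W U g"
  shows "linear_map K V U (g \<circ> f)"
  using linear_mapD[OF assms(1)] linear_mapD[OF assms(2)] by (intro linear_mapI) auto

lemma linear_map_id: "vectorspace K V \<Longrightarrow> linear_map K V V id"
  by (intro linear_mapI) auto

lemma linear_map_scale:
  assumes "vectorspace K V" "c \<in> carrier K"
  shows "linear_map K V V (\<lambda>x. c \<odot>\<^bsub>V\<^esub> x)"
proof -
  interpret V: module K V using assms by (simp add: vectorspace_def)
  show ?thesis using assms
    by (intro linear_mapI) (auto simp: V.smult_r_distr V.smult_assoc1[symmetric] V.R.m_comm)
qed

lemma linear_map_add:
  assumes "linear_map K V W f" "linear_map K V W g"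
  shows "linear_map K V W (\<lambda>x. f x \<oplus>\<^bsub>W\<^esub> g x)"
proof -
  interpret W: module K W using assms by (simp add: linear_map_def mod_hom_def)
  show ?thesis using linear_mapD[OF assms(1)] linear_mapD[OF assms(2)]
    by (intro linear_mapI) (auto simp: W.smult_r_distr W.a_ac)
qed

lemma bilinear_mapD:
  assumes "bilinear_map K V W U f"
  shows "w \<in> carrier W \<Longrightarrow> linear_map K V U (\<lambda>v. f v w)" "v \<in> carrier V \<Longrightarrow> linear_map K W U (f v)"
  using assms by (auto simp: bilinear_map_def)

lemma bilinear_map_comp:
  assumes "bilinear_map K V W U h" "linear_map K V' V f" "linear_map K W' W g"
  shows "bilinear_map K V' W' U (\<lambda>v w. h (f v) (g w))"
  unfolding bilinear_map_def
proof (intro conjI ballI)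
  fix w assume "w \<in> carrier W'"
  then have "linear_map K V U (\<lambda>v. h v (g w))"
    by (intro bilinear_mapD(1)[OF assms(1)] linear_mapD(4)[OF assms(3)])
  from linear_map_comp[OF assms(2) this] show "linear_map K V' U (\<lambda>v. h (f v) (g w))" by (simp add: o_def)
next
  fix v assume "v \<in> carrier V'"
  then have "linear_map K W U (h (f v))"
    by (intro bilinear_mapD(2)[OF assms(1)] linear_mapD(4)[OF assms(2)])
  from linear_map_comp[OF assms(3) this] show "linear_map K W' U (\<lambda>w. h (f v) (g w))" by (simp add: o_def)
qed

section \<open>Canonical maps between tensor products\<close>

text \<open>
  Rebracketing maps are iterated lifts, so bilinearity of the outer argument requires that a lift
  depends linearly on the map being lifted. Both sides of each linearity law are linear
  on \<open>V \<otimes> W\<close>, so they only have to be compared on pure tensors, where the law is assumed.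
\<close>
lemma (in tensor_product) lift_linear_in_parameter:
  assumes S: "vectorspace K S" and U: "vectorspace K U"
    and bil: "\<And>s. s \<in> carrier S \<Longrightarrow> bilinear_map K V W U (f s)"
    and lin: "\<And>v w. v \<in> carrier V \<Longrightarrow> w \<in> carrier W \<Longrightarrow> linear_map K S U (\<lambda>s. f s v w)"
    and x: "x \<in> carrier (tensor_vs K V W)"
  shows "linear_map K S U (\<lambda>s. tensor_lift K V W U (f s) x)"
proof -
  interpret S: module K S using S by (simp add: vectorspace_def)
  note L = lift[OF U bil]
  show ?thesis
  proof (rule linear_mapI[OF S U])
    fix s assume "s \<in> carrier S"
    then show "tensor_lift K V W U (f s) x \<in> carrier U" by (intro linear_mapD(4)[OF L(1)] x)
  next
    fix s s' assume s: "s \<in> carrier S" "s' \<in> carrier S"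
    then have ss: "s \<oplus>\<^bsub>S\<^esub> s' \<in> carrier S" by simp
    show "tensor_lift K V W U (f (s \<oplus>\<^bsub>S\<^esub> s')) x
        = tensor_lift K V W U (f s) x \<oplus>\<^bsub>U\<^esub> tensor_lift K V W U (f s') x"
      by (rule linear_eqI[OF L(1)[OF ss] linear_map_add[OF L(1) L(1)] _ x])
        (simp_all add: s ss L(2) linear_mapD(5)[OF lin])
  next
    fix c s assume c: "c \<in> carrier K" and s: "s \<in> carrier S"
    then have cs: "c \<odot>\<^bsub>S\<^esub> s \<in> carrier S" by simp
    show "tensor_lift K V W U (f (c \<odot>\<^bsub>S\<^esub> s)) x = c \<odot>\<^bsub>U\<^esub> tensor_lift K V W U (f s) x"
      by (rule linear_eqI[OF L(1)[OF cs] linear_map_comp[OF L(1) linear_map_scale[OF U c], unfolded o_def] _ x])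
        (simp_all add: c s cs L(2) linear_mapD(6)[OF lin])
  qed
qed

lemma tensor_map_linear:
  assumes f: "linear_map K V V' f" and g: "linear_map K W W' g"
  shows "linear_map K (tensor_vs K V W) (tensor_vs K V' W') (tensor_map K V V' W W' f g)"
    and "\<And>v w. v \<in> carrier V \<Longrightarrow> w \<in> carrier W \<Longrightarrow>
      tensor_map K V V' W W' f g (pure_tensor K V W v w) = pure_tensor K V' W' (f v) (g w)"
proof -
  interpret T: tensor_product K V W by (intro tensor_product.intro linear_mapD[OF f] linear_mapD[OF g])
  interpret T': tensor_product K V' W' by (intro tensor_product.intro linear_mapD[OF f] linear_mapD[OF g])
  note L = T.lift[OF T'.vectorspace_T bilinear_map_comp[OF T'.bilinear_pure f g], folded tensor_map_def]
  show "linear_map K (tensor_vs K V W) (tensor_vs K V' W') (tensor_map K V V' W W' f g)" by (rule L(1))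
  show "tensor_map K V V' W W' f g (pure_tensor K V W v w) = pure_tensor K V' W' (f v) (g w)"
    if "v \<in> carrier V" "w \<in> carrier W" for v w using that by (rule L(2))
qed

lemma (in tensor_product) tensor_flip_linear:
  shows "linear_map K (tensor_vs K V W) (tensor_vs K W V) (tensor_flip K V W)"
    and "\<And>v w. v \<in> carrier V \<Longrightarrow> w \<in> carrier W \<Longrightarrow>
      tensor_flip K V W (pure_tensor K V W v w) = pure_tensor K W V w v"
proof -
  interpret T': tensor_product K W V by (intro tensor_product.intro vectorspace_V vectorspace_W)
  have "bilinear_map K V W (tensor_vs K W V) (\<lambda>v w. pure_tensor K W V w v)"
    using T'.bilinear_pure by (simp add: bilinear_map_def)
  note L = lift[OF T'.vectorspace_T this, folded tensor_flip_def]
  show "linear_map K (tensor_vs K V W) (tensor_vs K W V) (tensor_flip K V W)" by (rule L(1))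
  show "tensor_flip K V W (pure_tensor K V W v w) = pure_tensor K W V w v"
    if "v \<in> carrier V" "w \<in> carrier W" for v w using that by (rule L(2))
qed

locale tensor3 =
  fixes K :: "('k, 'm) ring_scheme"
    and V :: "('k, 'a, 'n) module_scheme"
    and W :: "('k, 'b, 'p) module_scheme"
    and U :: "('k, 'c, 'q) module_scheme"
  assumes vectorspace_V: "vectorspace K V" and vectorspace_W: "vectorspace K W"
    and vectorspace_U: "vectorspace K U"
begin

sublocale VW: tensor_product K V W by (intro tensor_product.intro vectorspace_V vectorspace_W)
sublocale WU: tensor_product K W U by (intro tensor_product.intro vectorspace_W vectorspace_U)
sublocale VW_U: tensor_product K "tensor_vs K V W" U
  by (intro tensor_product.intro VW.vectorspace_T vectorspace_U)
sublocale V_WU: tensor_product K V "tensor_vs K W U"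
  by (intro tensor_product.intro WU.vectorspace_T vectorspace_V)

lemma tensor_assoc_linear:
  shows "linear_map K (tensor_vs K (tensor_vs K V W) U) (tensor_vs K V (tensor_vs K W U)) (tensor_assoc K V W U)"
    and "\<And>v w u. v \<in> carrier V \<Longrightarrow> w \<in> carrier W \<Longrightarrow> u \<in> carrier U \<Longrightarrow>
      tensor_assoc K V W U (pure_tensor K (tensor_vs K V W) U (pure_tensor K V W v w) u)
      = pure_tensor K V (tensor_vs K W U) v (pure_tensor K W U w u)"
proof -
  let ?M = "tensor_vs K V (tensor_vs K W U)"
  let ?g = "\<lambda>v w u. pure_tensor K V (tensor_vs K W U) v (pure_tensor K W U w u)"
  have bil: "bilinear_map K V W ?M (\<lambda>v w. ?g v w u)" if "u \<in> carrier U" for u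
    using bilinear_map_comp[OF V_WU.bilinear_pure linear_map_id[OF vectorspace_V]
        bilinear_mapD(1)[OF WU.bilinear_pure that]] by simp
  have lin: "linear_map K U ?M (\<lambda>u. ?g v w u)" if "v \<in> carrier V" "w \<in> carrier W" for v w
    using linear_map_comp[OF bilinear_mapD(2)[OF WU.bilinear_pure that(2)]
        bilinear_mapD(2)[OF V_WU.bilinear_pure that(1)]] by (simp add: o_def)
  note L = VW.lift[OF V_WU.vectorspace_T bil]
  have "bilinear_map K (tensor_vs K V W) U ?M (\<lambda>x u. tensor_lift K V W ?M (\<lambda>v w. ?g v w u) x)"
    unfolding bilinear_map_def
    by (intro conjI ballI L(1) VW.lift_linear_in_parameter vectorspace_U V_WU.vectorspace_T bil lin)
  note L' = VW_U.lift[OF V_WU.vectorspace_T this]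
  have assoc_eq: "tensor_assoc K V W U = tensor_lift K (tensor_vs K V W) U ?M (\<lambda>x u. tensor_lift K V W ?M (\<lambda>v w. ?g v w u) x)"
    unfolding tensor_assoc_def Let_def by (rule refl)
  show "linear_map K (tensor_vs K (tensor_vs K V W) U) ?M (tensor_assoc K V W U)"
    unfolding assoc_eq by (rule L'(1))
  show "tensor_assoc K V W U (pure_tensor K (tensor_vs K V W) U (pure_tensor K V W v w) u) = ?g v w u"
    if "v \<in> carrier V" "w \<in> carrier W" "u \<in> carrier U" for v w u
    using that unfolding assoc_eq by (simp add: L' L VW.pure_closed)
qed

lemma tensor_assoc'_linear:
  shows "linear_map K (tensor_vs K V (tensor_vs K W U)) (tensor_vs K (tensor_vs K V W) U) (tensor_assoc' K V W U)"
    and "\<And>v w u. v \<in> carrier V \<Longrightarrow> w \<in> carrier W \<Longrightarrow> u \<in> carrier U \<Longrightarrow>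
      tensor_assoc' K V W U (pure_tensor K V (tensor_vs K W U) v (pure_tensor K W U w u))
      = pure_tensor K (tensor_vs K V W) U (pure_tensor K V W v w) u"
proof -
  let ?M = "tensor_vs K (tensor_vs K V W) U"
  let ?g = "\<lambda>v w u. pure_tensor K (tensor_vs K V W) U (pure_tensor K V W v w) u"
  have bil: "bilinear_map K W U ?M (?g v)" if "v \<in> carrier V" for v
    using bilinear_map_comp[OF VW_U.bilinear_pure
        bilinear_mapD(2)[OF VW.bilinear_pure that] linear_map_id[OF vectorspace_U]] by simp
  have lin: "linear_map K V ?M (\<lambda>v. ?g v w u)" if "w \<in> carrier W" "u \<in> carrier U" for w u
    using linear_map_comp[OF bilinear_mapD(1)[OF VW.bilinear_pure that(1)]
        bilinear_mapD(1)[OF VW_U.bilinear_pure that(2)]] by (simp add: o_def)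
  note L = WU.lift[OF VW_U.vectorspace_T bil]
  have "bilinear_map K V (tensor_vs K W U) ?M (\<lambda>v. tensor_lift K W U ?M (?g v))"
    unfolding bilinear_map_def
    by (intro conjI ballI L(1) WU.lift_linear_in_parameter vectorspace_V VW_U.vectorspace_T bil lin)
  note L' = V_WU.lift[OF VW_U.vectorspace_T this]
  have assoc_eq: "tensor_assoc' K V W U = tensor_lift K V (tensor_vs K W U) ?M (\<lambda>v. tensor_lift K W U ?M (?g v))"
    unfolding tensor_assoc'_def Let_def by (rule refl)
  show "linear_map K (tensor_vs K V (tensor_vs K W U)) ?M (tensor_assoc' K V W U)"
    unfolding assoc_eq by (rule L'(1))
  show "tensor_assoc' K V W U (pure_tensor K V (tensor_vs K W U) v (pure_tensor K W U w u)) = ?g v w u"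
    if "v \<in> carrier V" "w \<in> carrier W" "u \<in> carrier U" for v w u
    using that unfolding assoc_eq by (simp add: L' L WU.pure_closed)
qed

text \<open>A pure tensor of \<open>(V \<otimes> W) \<otimes> U\<close> may have an arbitrary left factor, so the
  uniqueness of linear maps has to be used once for each of the two tensor products.\<close>
lemma linear_eqI3:
  assumes f: "linear_map K (tensor3_vs K V W U) M f" and g: "linear_map K (tensor3_vs K V W U) M g"
    and eq: "\<And>v w u. v \<in> carrier V \<Longrightarrow> w \<in> carrier W \<Longrightarrow> u \<in> carrier U \<Longrightarrow>
      f (pure_tensor K (tensor_vs K V W) U (pure_tensor K V W v w) u)
      = g (pure_tensor K (tensor_vs K V W) U (pure_tensor K V W v w) u)"
    and x: "x \<in> carrier (tensor3_vs K V W U)"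
  shows "f x = g x"
proof (rule VW_U.linear_eqI[OF f g _ x])
  fix y u assume y: "y \<in> carrier (tensor_vs K V W)" and u: "u \<in> carrier U"
  note p = bilinear_mapD(1)[OF VW_U.bilinear_pure u]
  show "f (pure_tensor K (tensor_vs K V W) U y u) = g (pure_tensor K (tensor_vs K V W) U y u)"
    by (rule VW.linear_eqI[OF linear_map_comp[OF p f] linear_map_comp[OF p g] _ y, unfolded o_def])
      (use u eq in simp)
qed

text \<open>
  The maps acting on two of the three factors. For the second and third factor and for the outer
  factors the value on a pure tensor still contains a rebracketing: it disappears only
  after \<open>T\<close> or \<open>S\<close> has been expanded into pure tensors.
\<close>
abbreviation (input) "pure3 v w u \<equiv> pure_tensor K (tensor_vs K V W) U (pure_tensor K V W v w) u"

lemma leg12_linear: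
  assumes R: "linear_map K (tensor_vs K V W) (tensor_vs K V W) R" and \<gamma>: "linear_map K U U \<gamma>"
  shows "linear_map K (tensor3_vs K V W U) (tensor3_vs K V W U) (leg12 K V W U \<gamma> R)"
    and "\<And>x u. x \<in> carrier (tensor_vs K V W) \<Longrightarrow> u \<in> carrier U \<Longrightarrow>
      leg12 K V W U \<gamma> R (pure_tensor K (tensor_vs K V W) U x u) = pure_tensor K (tensor_vs K V W) U (R x) (\<gamma> u)"
  unfolding leg12_def by (intro tensor_map_linear R \<gamma>; assumption)+

lemma leg23_linear:
  assumes T: "linear_map K (tensor_vs K W U) (tensor_vs K W U) T" and \<alpha>: "linear_map K V V \<alpha>"
  shows "linear_map K (tensor3_vs K V W U) (tensor3_vs K V W U) (leg23 K V W U \<alpha> T)"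
    and "\<And>v w u. v \<in> carrier V \<Longrightarrow> w \<in> carrier W \<Longrightarrow> u \<in> carrier U \<Longrightarrow>
      leg23 K V W U \<alpha> T (pure3 v w u)
      = tensor_assoc' K V W U (pure_tensor K V (tensor_vs K W U) (\<alpha> v) (T (pure_tensor K W U w u)))"
proof -
  note M = tensor_map_linear[OF \<alpha> T]
  show "linear_map K (tensor3_vs K V W U) (tensor3_vs K V W U) (leg23 K V W U \<alpha> T)"
    unfolding leg23_def
    by (rule linear_map_comp[OF tensor_assoc_linear(1) linear_map_comp[OF M(1) tensor_assoc'_linear(1)]])
  show "leg23 K V W U \<alpha> T (pure3 v w u)
      = tensor_assoc' K V W U (pure_tensor K V (tensor_vs K W U) (\<alpha> v) (T (pure_tensor K W U w u)))"
    if "v \<in> carrier V" "w \<in> carrier W" "u \<in> carrier U" for v w u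
    using that by (simp add: leg23_def tensor_assoc_linear(2) M(2) WU.pure_closed)
qed

lemma leg13_linear:
  assumes S: "linear_map K (tensor_vs K V U) (tensor_vs K V U) S" and \<beta>: "linear_map K W W \<beta>"
  shows "linear_map K (tensor3_vs K V W U) (tensor3_vs K V W U) (leg13 K V W U \<beta> S)"
    and "\<And>v w u. v \<in> carrier V \<Longrightarrow> w \<in> carrier W \<Longrightarrow> u \<in> carrier U \<Longrightarrow>
      leg13 K V W U \<beta> S (pure3 v w u)
      = tensor_map K (tensor_vs K W V) (tensor_vs K V W) U U (tensor_flip K W V) id
          (tensor_assoc' K W V U (pure_tensor K W (tensor_vs K V U) (\<beta> w) (S (pure_tensor K V U v u))))"
proof -
  interpret t: tensor3 K W V U by (intro tensor3.intro vectorspace_V vectorspace_W vectorspace_U)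
  note id = linear_map_id[OF vectorspace_U]
  note F = tensor_map_linear[OF VW.tensor_flip_linear(1) id]
  note F' = tensor_map_linear[OF t.VW.tensor_flip_linear(1) id]
  show "linear_map K (tensor3_vs K V W U) (tensor3_vs K V W U) (leg13 K V W U \<beta> S)"
    unfolding leg13_def
    by (rule linear_map_comp[OF F(1) linear_map_comp[OF t.leg23_linear(1)[OF S \<beta>] F'(1)]])
  show "leg13 K V W U \<beta> S (pure3 v w u)
      = tensor_map K (tensor_vs K W V) (tensor_vs K V W) U U (tensor_flip K W V) id
          (tensor_assoc' K W V U (pure_tensor K W (tensor_vs K V U) (\<beta> w) (S (pure_tensor K V U v u))))"
    if "v \<in> carrier V" "w \<in> carrier W" "u \<in> carrier U" for v w u
    using that by (simp add: leg13_def F(2) VW.pure_closed VW.tensor_flip_linear(2) t.leg23_linear(2)[OF S \<beta>])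
qed

end

section \<open>Comparison of coefficients\<close>

text \<open>
  The shape of all the operators considered: \<open>a \<otimes> b\<close> is sent to such a combination of
  \<open>ab \<otimes> 1\<close>, \<open>1 \<otimes> ab\<close> and \<open>\<alpha>(b) \<otimes> \<alpha>(a)\<close>. Keeping it folded keeps
  the threefold composites readable as trees of depth three.
\<close>
definition tricomb ::
  "('k, 'a, 'n) module_scheme \<Rightarrow> 'k \<Rightarrow> 'k \<Rightarrow> 'a \<Rightarrow> 'a \<Rightarrow> 'a \<Rightarrow> 'a" where
  "tricomb M r s x y z = r \<odot>\<^bsub>M\<^esub> x \<oplus>\<^bsub>M\<^esub> s \<odot>\<^bsub>M\<^esub> y \<ominus>\<^bsub>M\<^esub> z"

lemma (in module) tricomb_closed:
  assumes "r \<in> carrier R" "s \<in> carrier R" "x \<in> carrier M" "y \<in> carrier M" "z \<in> carrier M"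
  shows "tricomb M r s x y z \<in> carrier M"
  using assms by (simp add: tricomb_def)

lemma (in mod_hom) hom_tricomb:
  assumes "r \<in> carrier R" "s \<in> carrier R" "x \<in> carrier M" "y \<in> carrier M" "z \<in> carrier M"
  shows "f (tricomb M r s x y z) = tricomb N r s (f x) (f y) (f z)"
  using assms by (simp add: tricomb_def f_minus)

lemma linear_tricomb:
  assumes "linear_map K V W f" "r \<in> carrier K" "s \<in> carrier K" "x \<in> carrier V" "y \<in> carrier V" "z \<in> carrier V"
  shows "f (tricomb V r s x y z) = tricomb W r s (f x) (f y) (f z)"
  by (rule mod_hom.hom_tricomb[OF linear_mapD(3)[OF assms(1)] assms(2-)])

lemma free_vs_tricomb:
  assumes "cring K" "r \<in> carrier K" "s \<in> carrier K" "i \<in> I"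
    and \<phi>: "\<phi> \<in> carrier (free_vs K I)" and \<psi>: "\<psi> \<in> carrier (free_vs K I)" and \<chi>: "\<chi> \<in> carrier (free_vs K I)"
  shows "tricomb (free_vs K I) r s \<phi> \<psi> \<chi> i = r \<otimes>\<^bsub>K\<^esub> \<phi> i \<oplus>\<^bsub>K\<^esub> s \<otimes>\<^bsub>K\<^esub> \<psi> i \<ominus>\<^bsub>K\<^esub> \<chi> i"
proof -
  interpret K: cring K by fact
  interpret F: module K "free_vs K I" by (rule free_vs_module) fact
  have c: "\<chi> i \<in> carrier K" 
    using assms by (auto simp: free_vs_simps(1)[OF assms(1)] PiE_iff)
  have "\<ominus>\<^bsub>free_vs K I\<^esub> \<chi> = (\<ominus>\<^bsub>K\<^esub> \<one>\<^bsub>K\<^esub>) \<odot>\<^bsub>free_vs K I\<^esub> \<chi>"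
    using \<chi> by (simp add: F.smult_l_minus)
  then have "(\<ominus>\<^bsub>free_vs K I\<^esub> \<chi>) i = \<ominus>\<^bsub>K\<^esub> \<chi> i"
    using c \<open>i \<in> I\<close> by (simp add: free_vs_simps(4)[OF assms(1)] K.l_minus)
  then show ?thesis using \<open>i \<in> I\<close>
    by (simp add: tricomb_def a_minus_def free_vs_simps(3,4)[OF assms(1)])
qed

text \<open>
  The two composites \<open>R\<^sup>1\<^sup>2S\<^sup>1\<^sup>3T\<^sup>2\<^sup>3\<close> and \<open>T\<^sup>2\<^sup>3S\<^sup>1\<^sup>3R\<^sup>1\<^sup>2\<close> at \<open>a \<otimes> b \<otimes> c\<close>, for
  operators with coefficients \<open>(r, s)\<close>, \<open>(p, q)\<close> and \<open>(x, y)\<close>. Their \<open>27\<close> leaves are only ten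
  different tensors. Up to powers of \<open>\<alpha>\<close> on the factors, and with \<open>m = (ab)c = a(bc)\<close>, these are
  \<open>v 0 = m \<otimes> 1 \<otimes> 1\<close>, \<open>v 1 = 1 \<otimes> m \<otimes> 1\<close>, \<open>v 2 = 1 \<otimes> 1 \<otimes> m\<close>,
  \<open>v 3 = bc \<otimes> a \<otimes> 1\<close>, \<open>v 4 = bc \<otimes> 1 \<otimes> a\<close>, \<open>v 5 = 1 \<otimes> bc \<otimes> a\<close>,
  \<open>v 6 = c \<otimes> ab \<otimes> 1\<close>, \<open>v 7 = c \<otimes> 1 \<otimes> ab\<close>, \<open>v 8 = 1 \<otimes> c \<otimes> ab\<close> and
  \<open>v 9 = c \<otimes> b \<otimes> a\<close>. The family \<open>v\<close> is left arbitrary, because the comparison of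
  the two trees is a matter of coefficients alone.
\<close>
definition yb_left where
  "yb_left M r s p q x y v =
     tricomb M x y
       (tricomb M p q (tricomb M r s (v 0) (v 1) (v 3)) (tricomb M r s (v 4) (v 5) (v 4))
          (tricomb M r s (v 4) (v 5) (v 4)))
       (tricomb M p q (tricomb M r s (v 0) (v 1) (v 1)) (tricomb M r s (v 2) (v 2) (v 2))
          (tricomb M r s (v 4) (v 5) (v 5)))
       (tricomb M p q (tricomb M r s (v 0) (v 1) (v 6)) (tricomb M r s (v 7) (v 8) (v 7))
          (tricomb M r s (v 4) (v 5) (v (9::nat))))"

definition yb_right where
  "yb_right M r s p q x y v =
     tricomb M r s
       (tricomb M p q (tricomb M x y (v 0) (v 0) (v 0)) (tricomb M x y (v 1) (v 2) (v 1))
          (tricomb M x y (v 6) (v 7) (v 6)))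
       (tricomb M p q (tricomb M x y (v 6) (v 7) (v 7)) (tricomb M x y (v 1) (v 2) (v 8))
          (tricomb M x y (v 6) (v 7) (v 7)))
       (tricomb M p q (tricomb M x y (v 3) (v 4) (v 4)) (tricomb M x y (v 1) (v 2) (v 5))
          (tricomb M x y (v 6) (v 7) (v (9::nat))))"

lemma (in mod_hom) hom_yb:
  assumes "r \<in> carrier R" "s \<in> carrier R" "p \<in> carrier R" "q \<in> carrier R"
    "x \<in> carrier R" "y \<in> carrier R" "v \<in> {..<10} \<rightarrow> carrier M"
  shows "f (yb_left M r s p q x y v) = yb_left N r s p q x y (\<lambda>i. f (v i))"
    and "f (yb_right M r s p q x y v) = yb_right N r s p q x y (\<lambda>i. f (v i))"
  using assms by (simp_all add: yb_left_def yb_right_def hom_tricomb M.tricomb_closed Pi_iff)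

text \<open>Lets a polynomial \<open>e\<close> known to vanish enter the proof of an equation whose sides only take
  a usable form after simplification.\<close>
lemma (in cring) eq_by_difference:
  assumes "e = \<zero>" "a \<in> carrier R" "b \<in> carrier R" "a \<ominus> b = e"
  shows "a = b"
  using assms by (metis add.inv_closed add.inv_solve_right l_zero minus_eq zero_closed)

text \<open>
  The four equations come from comparing coefficients of the two trees. The coefficients
  at \<open>v 0\<close>, \<open>v 2\<close>, \<open>v 3\<close>, \<open>v 8\<close> and \<open>v 9\<close> agree identically. With \<open>E1\<close> to \<open>E4\<close> the
  differences of the two sides of the equations, those at \<open>v 4\<close>, \<open>v 5\<close>, \<open>v 6\<close>
  and \<open>v 7\<close> differ by \<open>E1\<close>, \<open>E2\<close>, \<open>-E3\<close> and \<open>-E4\<close>, and those at \<open>v 1\<close> by \<open>q E3 - p E2\<close>.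
  Since the vectors may be linearly dependent, coefficients make sense only in the free module on
  ten symbols; the identity is proved there and carried to \<open>M\<close> by the linear map \<open>e i \<mapsto> v i\<close>.
\<close>
lemma (in module) yb_left_eq_right:
  assumes [simp]: "r \<in> carrier R" "s \<in> carrier R" "p \<in> carrier R" "q \<in> carrier R"
    "x \<in> carrier R" "y \<in> carrier R"
    and v: "v \<in> {..<10::nat} \<rightarrow> carrier M"
    and c1: "x \<otimes> (q \<ominus> \<one>) \<otimes> (r \<ominus> \<one>) = (r \<ominus> p) \<otimes> (y \<ominus> \<one>)"
    and c2: "(q \<ominus> \<one>) \<otimes> (s \<otimes> x \<ominus> \<one>) = (s \<ominus> \<one>) \<otimes> (y \<ominus> \<one>)"
    and c3: "(p \<ominus> \<one>) \<otimes> (s \<otimes> x \<ominus> \<one>) = (r \<ominus> \<one>) \<otimes> (x \<ominus> \<one>)"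
    and c4: "s \<otimes> (p \<ominus> \<one>) \<otimes> (y \<ominus> \<one>) = (r \<ominus> \<one>) \<otimes> (y \<ominus> q)"
  shows "yb_left M r s p q x y v = yb_right M r s p q x y v"
proof -
  define I where "I = {..<10::nat}"
  define F where "F = free_vs R I"
  define e where "e = free_unit R I"
  interpret F: module R F unfolding F_def by (rule free_vs_module) (rule R.cring_axioms)
  interpret L: mod_hom R F M "free_lift R I M v"
    using v unfolding F_def I_def by (intro free_lift_hom module_axioms)
  have e_closed [simp]: "e i \<in> carrier F" if "i < 10" for i
    using that unfolding e_def F_def I_def by (intro free_unit_closed R.cring_axioms) auto
  then have e: "e \<in> {..<10} \<rightarrow> carrier F" by simp
  have Le: "free_lift R I M v (e i) = v i" if "i < 10" for i
    using v that unfolding e_def I_def by (intro free_lift_unit module_axioms) auto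
  have e_val: "e j i = (if j = i then \<one> else \<zero>)" if "i < 10" for i j
    using that by (auto simp: e_def free_unit_def I_def)
  note tc = F.tricomb_closed
  have tv: "tricomb F a b \<phi> \<psi> \<chi> i = a \<otimes> \<phi> i \<oplus> b \<otimes> \<psi> i \<ominus> \<chi> i"
    if "a \<in> carrier R" "b \<in> carrier R" "\<phi> \<in> carrier F" "\<psi> \<in> carrier F" "\<chi> \<in> carrier F" "i < 10"
    for a b \<phi> \<psi> \<chi> i
    using that unfolding F_def by (intro free_vs_tricomb R.cring_axioms) (auto simp: I_def)
  define E1 where "E1 = x \<otimes> (q \<ominus> \<one>) \<otimes> (r \<ominus> \<one>) \<ominus> (r \<ominus> p) \<otimes> (y \<ominus> \<one>)"
  define E2 where "E2 = (q \<ominus> \<one>) \<otimes> (s \<otimes> x \<ominus> \<one>) \<ominus> (s \<ominus> \<one>) \<otimes> (y \<ominus> \<one>)"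
  define E3 where "E3 = (p \<ominus> \<one>) \<otimes> (s \<otimes> x \<ominus> \<one>) \<ominus> (r \<ominus> \<one>) \<otimes> (x \<ominus> \<one>)"
  define E4 where "E4 = s \<otimes> (p \<ominus> \<one>) \<otimes> (y \<ominus> \<one>) \<ominus> (r \<ominus> \<one>) \<otimes> (y \<ominus> q)"
  have E0: "E1 = \<zero>" "E2 = \<zero>" "E3 = \<zero>" "E4 = \<zero>"
    unfolding E1_def E2_def E3_def E4_def c1 c2 c3 c4 by (simp_all add: a_minus_def R.r_neg)
  have carr: "r \<in> carrier R" "s \<in> carrier R" "p \<in> carrier R" "q \<in> carrier R"
    "x \<in> carrier R" "y \<in> carrier R" by simp_all
  have sub0: "\<zero> \<ominus> a = \<ominus> a" "a \<ominus> \<zero> = a" if "a \<in> carrier R" for a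
    using that by (simp_all add: a_minus_def)
  have coeff: "yb_left F r s p q x y e i = yb_right F r s p q x y e i" if i: "i < 10" for i
  proof -
    have "i \<in> {0, 1, 2, 3, 4, 5, 6, 7, 8, 9}"
      using i by (simp add: eval_nat_numeral less_Suc_eq)
    then consider "i = 0" | "i = 1" | "i = 2" | "i = 3" | "i = 4" | "i = 5" | "i = 6" | "i = 7" | "i = 8" | "i = 9"
      by blast
    then show ?thesis
    proof cases
      case 1
      show ?thesis unfolding 1 
        by (simp add: yb_left_def yb_right_def tc tv e_val sub0) (use carr in algebra)
    next
      case 2
      have z: "q \<otimes> E3 \<ominus> p \<otimes> E2 = \<zero>" by (simp add: E0 sub0)
      show ?thesis unfolding 2
        by (rule R.eq_by_difference[OF z]; simp add: yb_left_def yb_right_def tc tv e_val sub0 E2_def E3_def)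
           (use carr in algebra)
    next
      case 3
      show ?thesis unfolding 3
        by (simp add: yb_left_def yb_right_def tc tv e_val sub0) (use carr in algebra)
    next
      case 4
      show ?thesis unfolding 4
        by (simp add: yb_left_def yb_right_def tc tv e_val sub0) (use carr in algebra)
    next
      case 5
      show ?thesis unfolding 5
        by (rule R.eq_by_difference[OF E0(1)]; simp add: yb_left_def yb_right_def tc tv e_val sub0 E1_def)
           (use carr in algebra)
    next
      case 6
      show ?thesis unfolding 6
        by (rule R.eq_by_difference[OF E0(2)]; simp add: yb_left_def yb_right_def tc tv e_val sub0 E2_def)
           (use carr in algebra)
    next
      case 7
      have z: "\<ominus> E3 = \<zero>" by (simp add: E0)
      show ?thesis unfolding 7
        by (rule R.eq_by_difference[OF z]; simp add: yb_left_def yb_right_def tc tv e_val sub0 E3_def)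
           (use carr in algebra)
    next
      case 8
      have z: "\<ominus> E4 = \<zero>" by (simp add: E0)
      show ?thesis unfolding 8
        by (rule R.eq_by_difference[OF z]; simp add: yb_left_def yb_right_def tc tv e_val sub0 E4_def)
           (use carr in algebra)
    next
      case 9
      show ?thesis unfolding 9
        by (simp add: yb_left_def yb_right_def tc tv e_val sub0) (use carr in algebra)
    next
      case 10
      show ?thesis unfolding 10
        by (simp add: yb_left_def yb_right_def tc tv e_val sub0)
    qed
  qed
  have "yb_left F r s p q x y e \<in> carrier F" "yb_right F r s p q x y e \<in> carrier F"
    by (simp_all add: yb_left_def yb_right_def tc)
  then have "yb_left F r s p q x y e = yb_right F r s p q x y e"
    using coeff unfolding F_def free_vs_simps(1)[OF R.cring_axioms] I_def
    by (auto intro: PiE_ext)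
  then have "yb_left M r s p q x y (\<lambda>i. free_lift R I M v (e i)) = yb_right M r s p q x y (\<lambda>i. free_lift R I M v (e i))"
    using L.hom_yb[OF carr e] by simp
  then show ?thesis by (simp add: yb_left_def yb_right_def Le)
qed

section \<open>Commutators of the operators on a Hom-algebra\<close>

context hom_algebra
begin

abbreviation "AA \<equiv> tensor_vs K A A"
abbreviation "AAA \<equiv> tensor3_vs K A A A"
abbreviation "mul \<equiv> tensor_mult K A \<mu>"
abbreviation "t \<equiv> pure_tensor K A A"
abbreviation "t3 a b c \<equiv> pure_tensor K AA A (t a b) c"

sublocale T: tensor3 K A A A
  by (intro tensor3.intro vectorspace)

lemma alpha_closed: "a \<in> carrier A \<Longrightarrow> \<alpha> a \<in> carrier A"
  by (rule linear_mapD(4)[OF linear_\<alpha>])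

lemma mul_closed: "a \<in> carrier A \<Longrightarrow> b \<in> carrier A \<Longrightarrow> mul a b \<in> carrier A"
  by (intro linear_mapD(4)[OF linear_\<mu>] T.VW.pure_closed)

lemmas closed = alpha_closed mul_closed unit_closed T.VW.pure_closed T.VW_U.pure_closed T.V_WU.pure_closed

text \<open>
  The operator with coefficients \<open>(r, s)\<close>: in the theorem, \<open>W\<close> has \<open>(1, \<lambda>)\<close>, \<open>Z\<close> has
  \<open>(\<nu>, 1)\<close> and \<open>X\<close> has \<open>(1, 1)\<close>. It is a predicate on linear maps rather than a particular lift,
  so that it applies to formulas in which a coefficient \<open>1\<close> is not written.
\<close>
definition yb_operator where
  "yb_operator r s R \<longleftrightarrow> r \<in> carrier K \<and> s \<in> carrier K \<and> linear_map K AA AA R \<and>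
     (\<forall>a\<in>carrier A. \<forall>b\<in>carrier A. R (t a b) = tricomb AA r s (t (mul a b) u) (t u (mul a b)) (t (\<alpha> b) (\<alpha> a)))"

lemma yb_operatorD:
  assumes "yb_operator r s R"
  shows "r \<in> carrier K" "s \<in> carrier K" "linear_map K AA AA R"
    and "a \<in> carrier A \<Longrightarrow> b \<in> carrier A \<Longrightarrow>
      R (t a b) = tricomb AA r s (t (mul a b) u) (t u (mul a b)) (t (\<alpha> b) (\<alpha> a))"
  using assms by (auto simp: yb_operator_def)

lemma leg12_pure:
  assumes R: "yb_operator r s R" and abc: "a \<in> carrier A" "b \<in> carrier A" "c \<in> carrier A"
  shows "leg12 K A A A \<alpha> R (t3 a b c) =
    tricomb AAA r s (t3 (mul a b) u (\<alpha> c)) (t3 u (mul a b) (\<alpha> c)) (t3 (\<alpha> b) (\<alpha> a) (\<alpha> c))"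
  using abc
  by (simp add: T.leg12_linear(2)[OF yb_operatorD(3)[OF R] linear_\<alpha>] closed yb_operatorD[OF R]
      linear_tricomb[OF bilinear_mapD(1)[OF T.VW_U.bilinear_pure]])

lemma leg23_pure:
  assumes R: "yb_operator r s R" and abc: "a \<in> carrier A" "b \<in> carrier A" "c \<in> carrier A"
  shows "leg23 K A A A \<alpha> R (t3 a b c) =
    tricomb AAA r s (t3 (\<alpha> a) (mul b c) u) (t3 (\<alpha> a) u (mul b c)) (t3 (\<alpha> a) (\<alpha> c) (\<alpha> b))"
  using abc
  by (simp add: T.leg23_linear(2)[OF yb_operatorD(3)[OF R] linear_\<alpha>] closed yb_operatorD[OF R]
      linear_tricomb[OF bilinear_mapD(2)[OF T.V_WU.bilinear_pure]]
      linear_tricomb[OF T.tensor_assoc'_linear(1)] T.tensor_assoc'_linear(2))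

lemma leg13_pure:
  assumes R: "yb_operator r s R" and abc: "a \<in> carrier A" "b \<in> carrier A" "c \<in> carrier A"
  shows "leg13 K A A A \<alpha> R (t3 a b c) =
    tricomb AAA r s (t3 (mul a c) (\<alpha> b) u) (t3 u (\<alpha> b) (mul a c)) (t3 (\<alpha> c) (\<alpha> b) (\<alpha> a))"
proof -
  note F = tensor_map_linear[OF T.VW.tensor_flip_linear(1) linear_map_id[OF vectorspace]]
  show ?thesis using abc
    by (simp add: T.leg13_linear(2)[OF yb_operatorD(3)[OF R] linear_\<alpha>] closed yb_operatorD[OF R]
        linear_tricomb[OF bilinear_mapD(2)[OF T.V_WU.bilinear_pure]]
        linear_tricomb[OF T.tensor_assoc'_linear(1)] T.tensor_assoc'_linear(2)
        linear_tricomb[OF F(1)] F(2) T.VW.tensor_flip_linear(2))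
qed

text \<open>
  On a pure tensor both composites unfold to the trees \<^const>\<open>yb_left\<close> and \<^const>\<open>yb_right\<close> over the
  same ten tensors. This is where the Hom-algebra axioms enter: multiplicativity of \<open>\<alpha>\<close>
  moves \<open>\<alpha>\<close> to the factors, the unit laws replace \<open>1a\<close> and \<open>a1\<close> by \<open>\<alpha>(a)\<close>, and
  Hom-associativity identifies the triple products, whichever of \<open>ab\<close> and \<open>bc\<close> is formed first.
\<close>
lemma commutator_eq_zero:
  assumes R: "yb_operator r s R" and S: "yb_operator p q S" and T: "yb_operator x y T"
    and c: "x \<otimes>\<^bsub>K\<^esub> (q \<ominus>\<^bsub>K\<^esub> \<one>\<^bsub>K\<^esub>) \<otimes>\<^bsub>K\<^esub> (r \<ominus>\<^bsub>K\<^esub> \<one>\<^bsub>K\<^esub>) = (r \<ominus>\<^bsub>K\<^esub> p) \<otimes>\<^bsub>K\<^esub> (y \<ominus>\<^bsub>K\<^esub> \<one>\<^bsub>K\<^esub>)"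
     "(q \<ominus>\<^bsub>K\<^esub> \<one>\<^bsub>K\<^esub>) \<otimes>\<^bsub>K\<^esub> (s \<otimes>\<^bsub>K\<^esub> x \<ominus>\<^bsub>K\<^esub> \<one>\<^bsub>K\<^esub>) = (s \<ominus>\<^bsub>K\<^esub> \<one>\<^bsub>K\<^esub>) \<otimes>\<^bsub>K\<^esub> (y \<ominus>\<^bsub>K\<^esub> \<one>\<^bsub>K\<^esub>)"
     "(p \<ominus>\<^bsub>K\<^esub> \<one>\<^bsub>K\<^esub>) \<otimes>\<^bsub>K\<^esub> (s \<otimes>\<^bsub>K\<^esub> x \<ominus>\<^bsub>K\<^esub> \<one>\<^bsub>K\<^esub>) = (r \<ominus>\<^bsub>K\<^esub> \<one>\<^bsub>K\<^esub>) \<otimes>\<^bsub>K\<^esub> (x \<ominus>\<^bsub>K\<^esub> \<one>\<^bsub>K\<^esub>)"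
     "s \<otimes>\<^bsub>K\<^esub> (p \<ominus>\<^bsub>K\<^esub> \<one>\<^bsub>K\<^esub>) \<otimes>\<^bsub>K\<^esub> (y \<ominus>\<^bsub>K\<^esub> \<one>\<^bsub>K\<^esub>) = (r \<ominus>\<^bsub>K\<^esub> \<one>\<^bsub>K\<^esub>) \<otimes>\<^bsub>K\<^esub> (y \<ominus>\<^bsub>K\<^esub> q)"
    and z: "z \<in> carrier AAA"
  shows "hom_yb_commutator K A \<alpha> A \<alpha> A \<alpha> R S T z = \<zero>\<^bsub>AAA\<^esub>"
proof -
  interpret M: module K AAA by (rule T.VW_U.module_T)
  note K = yb_operatorD(1,2)[OF R] yb_operatorD(1,2)[OF S] yb_operatorD(1,2)[OF T]
  note LR = T.leg12_linear(1)[OF yb_operatorD(3)[OF R] linear_\<alpha>]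
  note LS = T.leg13_linear(1)[OF yb_operatorD(3)[OF S] linear_\<alpha>]
  note LT = T.leg23_linear(1)[OF yb_operatorD(3)[OF T] linear_\<alpha>]
  let ?f = "leg12 K A A A \<alpha> R \<circ> leg13 K A A A \<alpha> S \<circ> leg23 K A A A \<alpha> T"
  let ?g = "leg23 K A A A \<alpha> T \<circ> leg13 K A A A \<alpha> S \<circ> leg12 K A A A \<alpha> R"
  have lf: "linear_map K AAA AAA ?f" by (rule linear_map_comp[OF LT linear_map_comp[OF LS LR]])
  have lg: "linear_map K AAA AAA ?g" by (rule linear_map_comp[OF LR linear_map_comp[OF LS LT]])
  have "?f z = ?g z"
  proof (rule T.linear_eqI3[OF lf lg _ z])
    fix a b c assume abc: "a \<in> carrier A" "b \<in> carrier A" "c \<in> carrier A"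
    \<comment> \<open>Each of the three legs multiplies a letter by another one or applies \<open>\<alpha>\<close> to it, and multiplying
      by the unit also applies \<open>\<alpha>\<close>. So a letter carries \<open>\<alpha>\<close> three times, less the number of its
      products with other letters; \<open>m\<close> is the bracketing in which \<open>c\<close> is multiplied last.\<close>
    define m where "m = mul (mul (\<alpha> a) (\<alpha> b)) (\<alpha> (\<alpha> c))"
    define ab where "ab = mul (\<alpha> (\<alpha> a)) (\<alpha> (\<alpha> b))"
    define bc where "bc = mul (\<alpha> (\<alpha> b)) (\<alpha> (\<alpha> c))"
    define a3 where "a3 = \<alpha> (\<alpha> (\<alpha> a))"
    define c3 where "c3 = \<alpha> (\<alpha> (\<alpha> c))"
    define v where "v = (!) [t3 m u u, t3 u m u, t3 u u m, t3 bc a3 u, t3 bc u a3, t3 u bc a3,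
      t3 c3 ab u, t3 c3 u ab, t3 u c3 ab, t3 c3 (\<alpha> (\<alpha> (\<alpha> b))) a3]"
    have v: "v \<in> {..<10} \<rightarrow> carrier AAA"
      unfolding v_def m_def ab_def bc_def a3_def c3_def using abc
      by (auto simp: closed eval_nat_numeral less_Suc_eq)
    note ev = closed K \<alpha>_mult \<alpha>_unit hom_assoc unit_left unit_right M.tricomb_closed
      linear_tricomb[OF LR] linear_tricomb[OF LS] linear_tricomb[OF LT]
      leg12_pure[OF R] leg13_pure[OF S] leg23_pure[OF T]
    have "?f (t3 a b c) = yb_left AAA r s p q x y v"
      using abc by (simp add: yb_left_def v_def m_def ab_def bc_def a3_def c3_def ev)
    also have "\<dots> = yb_right AAA r s p q x y v"
      by (rule M.yb_left_eq_right[OF K v c])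
    also have "\<dots> = ?g (t3 a b c)"
      using abc by (simp add: yb_right_def v_def m_def ab_def bc_def a3_def c3_def ev)
    finally show "?f (t3 a b c) = ?g (t3 a b c)" .
  qed
  then show ?thesis
    using linear_mapD(4)[OF lg z] unfolding hom_yb_commutator_def Let_def
    by (simp add: a_minus_def M.r_neg)
qed

lemma lift_yb_operator:
  assumes "r \<in> carrier K" "s \<in> carrier K"
    and f: "\<And>a b. a \<in> carrier A \<Longrightarrow> b \<in> carrier A \<Longrightarrow>
      f a b = tricomb AA r s (t (mul a b) u) (t u (mul a b)) (t (\<alpha> b) (\<alpha> a))"
  shows "yb_operator r s (tensor_lift K A A AA f)"
proof -
  interpret R: cring K by (rule T.VW.cring_K)
  interpret A: module K A using vectorspace by (simp add: vectorspace_def)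
  interpret M: module K AA by (rule T.VW.module_T)
  note simps = tricomb_def a_minus_def f closed assms(1,2) T.VW.pure_add_left T.VW.pure_add_right
    T.VW.pure_smult_left T.VW.pure_smult_right linear_mapD(5)[OF linear_\<alpha>] linear_mapD(6)[OF linear_\<alpha>]
    linear_mapD(5)[OF linear_\<mu>] linear_mapD(6)[OF linear_\<mu>]
    M.smult_r_distr M.minus_add M.smult_r_minus M.a_ac
  have comm: "r \<odot>\<^bsub>AA\<^esub> (c \<odot>\<^bsub>AA\<^esub> z) = c \<odot>\<^bsub>AA\<^esub> (r \<odot>\<^bsub>AA\<^esub> z)" if "r \<in> carrier K" "c \<in> carrier K" "z \<in> carrier AA" for r c z
    using that by (simp add: M.smult_assoc1[symmetric] R.m_comm)
  have "bilinear_map K A A AA f"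
    unfolding bilinear_map_def
    by (intro conjI ballI linear_mapI vectorspace T.VW.vectorspace_T)
      (simp_all add: simps comm[OF assms(1)] comm[OF assms(2)])
  note L = T.VW.lift[OF T.VW.vectorspace_T this]
  show ?thesis unfolding yb_operator_def using assms by (simp add: L)
qed

end

theorem theorem5p2:
  fixes K :: "('k, 'm) ring_scheme"
    and A :: "('k, 'a, 'n) module_scheme"
    and \<mu> :: "('a \<times> 'a \<Rightarrow> 'k) set \<Rightarrow> 'a" and u :: 'a and \<alpha> :: "'a \<Rightarrow> 'a"
    and lam \<nu> :: 'k
    and W Z X :: "('a \<times> 'a \<Rightarrow> 'k) set \<Rightarrow> ('a \<times> 'a \<Rightarrow> 'k) set"
  defines "AA \<equiv> tensor_vs K A A"
    and "t \<equiv> pure_tensor K A A"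
    and "p \<equiv> tensor_mult K A \<mu>"
  assumes "hom_algebra K A \<mu> u \<alpha>"
    and "lam \<in> carrier K" and "\<nu> \<in> carrier K"
    and "W = tensor_lift K A A AA
          (\<lambda>a b. t (p a b) u \<oplus>\<^bsub>AA\<^esub> lam \<odot>\<^bsub>AA\<^esub> t u (p a b) \<ominus>\<^bsub>AA\<^esub> t (\<alpha> b) (\<alpha> a))"
    and "Z = tensor_lift K A A AA
          (\<lambda>a b. \<nu> \<odot>\<^bsub>AA\<^esub> t (p a b) u \<oplus>\<^bsub>AA\<^esub> t u (p a b) \<ominus>\<^bsub>AA\<^esub> t (\<alpha> b) (\<alpha> a))"
    and "X = tensor_lift K A A AA
          (\<lambda>a b. t (p a b) u \<oplus>\<^bsub>AA\<^esub> t u (p a b) \<ominus>\<^bsub>AA\<^esub> t (\<alpha> b) (\<alpha> a))"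
  shows "hom_yb_system K A \<alpha> A \<alpha> W Z X"
proof -
  interpret hom_algebra K A \<mu> u \<alpha> by fact
  interpret R: cring K by (rule T.VW.cring_K)
  interpret M: module K "tensor_vs K A A" by (rule T.VW.module_T)
  note [simp] = \<open>lam \<in> carrier K\<close> \<open>\<nu> \<in> carrier K\<close>
  have W: "yb_operator \<one>\<^bsub>K\<^esub> lam W"
    unfolding assms(7) AA_def t_def p_def by (rule lift_yb_operator) (simp_all add: tricomb_def closed)
  have Z: "yb_operator \<nu> \<one>\<^bsub>K\<^esub> Z"
    unfolding assms(8) AA_def t_def p_def by (rule lift_yb_operator) (simp_all add: tricomb_def closed)
  have X: "yb_operator \<one>\<^bsub>K\<^esub> \<one>\<^bsub>K\<^esub> X"
    unfolding assms(9) AA_def t_def p_def by (rule lift_yb_operator) (simp_all add: tricomb_def closed)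
  have sub: "a \<ominus>\<^bsub>K\<^esub> a = \<zero>\<^bsub>K\<^esub>" if "a \<in> carrier K" for a
    using that by (simp add: a_minus_def R.r_neg)
  \<comment> \<open>In each coefficient equation both sides contain a factor \<open>1 - 1\<close> or \<open>\<nu> - \<nu>\<close>, except for
    one equation of \<open>[W, W, W]\<close>, where both sides are \<open>(\<lambda> - 1)(\<lambda> - 1)\<close>, and one
    of \<open>[Z, Z, Z]\<close>, where both sides are \<open>(\<nu> - 1)(\<nu> - 1)\<close>.\<close>
  show ?thesis
    by (intro hom_yb_system.intro linear_\<alpha> yb_operatorD(3)[OF W] yb_operatorD(3)[OF Z] yb_operatorD(3)[OF X]
        commutator_eq_zero[OF W W W] commutator_eq_zero[OF Z Z Z] commutator_eq_zero[OF W X X] commutator_eq_zero[OF X X Z])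
      (simp_all add: sub)
qed

end
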